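(* Let $d\geq 2$ and $n\geq 3$, let $P$ be the set of points and $H$ the set of hyperplanes of a $d$-dimensional finite projective space of order $n$, and let $A\in\{\pm1\}^{P\times H}$ be given by $A_{p,h}=1$ if $p\in h$ and $A_{p,h}=-1$ otherwise. Then $A$ is an $N\times N$ matrix with $N=N_{n,d}:=n^d+n^{d-1}+\dots+n+1=\frac{n^{d+1}-1}{n-1}$, its VC dimension is $d$, and its sign rank is larger than $$\frac{n^d-1}{n^{\frac{d-1}{2}}(n-1)}\geq N^{\frac12-\frac{1}{2d}}.$$
   Context: The sign rank of a $\pm1$ matrix $S$ is $\min\{\text{rank}(M): \text{sign}(M)=S\}$ over real matrices $M$ with no zero entries ($\text{sign}$ entrywise, rank over $\mathbb R$). A set $C$ of columns is shattered if every pattern in $\{\pm1\}^C$ appears as a row of the restriction to $C$; the VC dimension is the maximum size of a shattered set. *)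

theory Defs
  imports "HOL-Analysis.Analysis"
begin

text \<open>Projective spaces in the sense of Veblen and Young. Points are the elements of a
  finite type and lines are sets of points, so that non-Desarguesian planes are included.\<close>

locale projective_space =
  fixes lines :: "'p::finite set set"
  assumes line_unique: "p \<noteq> q \<Longrightarrow> \<exists>!l. l \<in> lines \<and> p \<in> l \<and> q \<in> l"
    and veblen_young:
      "\<lbrakk>distinct [a, b, c, d];
        ab \<in> lines; a \<in> ab; b \<in> ab; cd \<in> lines; c \<in> cd; d \<in> cd; ab \<inter> cd \<noteq> {};
        ac \<in> lines; a \<in> ac; c \<in> ac; bd \<in> lines; b \<in> bd; d \<in> bd\<rbrakk>
       \<Longrightarrow> ac \<inter> bd \<noteq> {}"
    and three_points: "l \<in> lines \<Longrightarrow> card l \<ge> 3"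

definition has_order :: "'p::finite set set \<Rightarrow> nat \<Rightarrow> bool" where
  "has_order lines n \<longleftrightarrow> (\<forall>l\<in>lines. card l = n + 1)"

definition proj_subspace :: "'p set set \<Rightarrow> 'p set \<Rightarrow> bool" where
  "proj_subspace lines X \<longleftrightarrow>
     (\<forall>l\<in>lines. \<forall>x\<in>X \<inter> l. \<forall>y\<in>X \<inter> l. x \<noteq> y \<longrightarrow> l \<subseteq> X)"

definition proj_span :: "'p set set \<Rightarrow> 'p set \<Rightarrow> 'p set" where
  "proj_span lines S = \<Inter>{X. proj_subspace lines X \<and> S \<subseteq> X}"

definition proj_independent :: "'p set set \<Rightarrow> 'p set \<Rightarrow> bool" where
  "proj_independent lines B \<longleftrightarrow> (\<forall>x\<in>B. x \<notin> proj_span lines (B - {x}))"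

text \<open>A subspace has dimension \<open>k\<close> if it has a basis of \<open>k + 1\<close> points (all bases have
  the same size by the exchange property).\<close>

definition has_proj_dim :: "'p::finite set set \<Rightarrow> 'p set \<Rightarrow> nat \<Rightarrow> bool" where
  "has_proj_dim lines X k \<longleftrightarrow>
     (\<exists>B. proj_independent lines B \<and> proj_span lines B = X \<and> card B = k + 1)"

definition hyperplanes :: "'p::finite set set \<Rightarrow> nat \<Rightarrow> 'p set set" where
  "hyperplanes lines d = {X. proj_subspace lines X \<and> has_proj_dim lines X (d - 1)}"

text \<open>Rows are indexed by points; columns by a finite type \<open>'h\<close> naming the hyperplanes,
  with \<open>hyp h\<close> the point set of the hyperplane named \<open>h\<close>.\<close>

definition signed_incidence :: "('h::finite \<Rightarrow> 'p::finite set) \<Rightarrow> real^'h^'p" where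
  "signed_incidence hyp = (\<chi> p h. if p \<in> hyp h then 1 else -1)"

definition sign_rank :: "real^'c::finite^'r::finite \<Rightarrow> nat" where
  "sign_rank S = (LEAST k. \<exists>M :: real^'c^'r.
     (\<forall>i j. M $ i $ j \<noteq> 0) \<and> (\<forall>i j. sgn (M $ i $ j) = S $ i $ j) \<and> rank M = k)"

definition shattered :: "real^'c::finite^'r::finite \<Rightarrow> 'c set \<Rightarrow> bool" where
  "shattered S C \<longleftrightarrow>
     (\<forall>f. (\<forall>j\<in>C. f j \<in> {-1, 1}) \<longrightarrow> (\<exists>i. \<forall>j\<in>C. S $ i $ j = f j))"

definition vc_dim :: "real^'c::finite^'r::finite \<Rightarrow> nat" where
  "vc_dim S = Max {card C | C. shattered S C}"

end

theory Submission
  imports Defs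
begin

text \<open>Join and exchange in a Veblen--Young space show that an independent set of \<open>r\<close> points spans
  \<open>1 + n + \<dots> + n\<^sup>r\<^sup>-\<^sup>1\<close> points, so dimension can be read off cardinalities; double counting then
  yields the number of hyperplanes through a given subspace. Intersecting shattered hyperplanes
  one at a time drops the dimension, whence the VC dimension is at most \<open>d\<close>, and the hyperplanes
  opposite to \<open>d\<close> of the \<open>d + 1\<close> points of a basis are shattered.

  For the sign rank, realise the signs as \<open>\<langle>x\<^sub>p, y\<^sub>h\<rangle>\<close> with vectors in a \<open>k\<close>-dimensional space.
  By Forster's argument a linear change of coordinates puts the normalised \<open>x\<^sub>p\<close> into nearly
  isotropic position, so \<open>\<Sum>p. \<bar>\<langle>x\<^sub>p, y\<^sub>h\<rangle>\<bar> \<ge> \<Sum>p. \<langle>x\<^sub>p, y\<^sub>h\<rangle>\<^sup>2 \<ge> N/k - \<epsilon>\<close>. Pair this with the incidence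
  matrix shifted by a constant \<open>\<theta>\<close>. With \<open>\<Delta>\<close> points on a hyperplane, any \<open>\<theta>\<close> with
  \<open>\<bar>N \<theta> - \<Delta>\<bar> \<le> n\<^bsup>(d-1)/2\<^esup>\<close> gives operator norm \<open>n\<^bsup>(d-1)/2\<^esup>\<close>; taking \<open>\<theta> = (\<Delta> + 1)/N\<close>
  rather than the balanced \<open>\<Delta>/N\<close> leaves enough room for \<open>\<epsilon> \<rightarrow> 0\<close> and a strict inequality.\<close>

section \<open>Veblen--Young geometry\<close>

lemma proj_subspace_UNIV: "proj_subspace lines UNIV"
  by (simp add: proj_subspace_def)

lemma proj_subspace_Inter:
  "(\<And>X. X \<in> F \<Longrightarrow> proj_subspace lines X) \<Longrightarrow> proj_subspace lines (\<Inter>F)"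
  unfolding proj_subspace_def by blast

lemma proj_subspace_span: "proj_subspace lines (proj_span lines S)"
  unfolding proj_span_def by (rule proj_subspace_Inter) auto

lemma proj_span_superset: "S \<subseteq> proj_span lines S"
  unfolding proj_span_def by auto

lemma proj_span_minimal: "proj_subspace lines X \<Longrightarrow> S \<subseteq> X \<Longrightarrow> proj_span lines S \<subseteq> X"
  unfolding proj_span_def by auto

lemma proj_span_mono: "S \<subseteq> T \<Longrightarrow> proj_span lines S \<subseteq> proj_span lines T"
  unfolding proj_span_def by auto

lemma proj_span_insert_span:
  "proj_span lines (insert p (proj_span lines S)) = proj_span lines (insert p S)"
proof
  have "proj_span lines S \<subseteq> proj_span lines (insert p S)"
    by (rule proj_span_mono) auto
  then show "proj_span lines (insert p (proj_span lines S)) \<subseteq> proj_span lines (insert p S)"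
    using proj_span_superset[of "insert p S" lines]
    by (intro proj_span_minimal proj_subspace_span) auto
  show "proj_span lines (insert p S) \<subseteq> proj_span lines (insert p (proj_span lines S))"
    using proj_span_superset[of S lines] by (intro proj_span_mono) auto
qed

lemma proj_subspaceD:
  "\<lbrakk>proj_subspace lines X; l \<in> lines; x \<in> X; y \<in> X; x \<in> l; y \<in> l; x \<noteq> y\<rbrakk> \<Longrightarrow> l \<subseteq> X"
  unfolding proj_subspace_def by blast

lemma proj_independent_subset:
  assumes "proj_independent lines B" "C \<subseteq> B" shows "proj_independent lines C"
  unfolding proj_independent_def
proof (intro ballI notI)
  fix x assume "x \<in> C" "x \<in> proj_span lines (C - {x})"
  moreover have "proj_span lines (C - {x}) \<subseteq> proj_span lines (B - {x})"
    using assms by (intro proj_span_mono) auto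
  ultimately show False
    using assms unfolding proj_independent_def by blast
qed

section \<open>Joins, the exchange property and bases\<close>

context projective_space
begin

definition line :: "'p \<Rightarrow> 'p \<Rightarrow> 'p set" where
  "line p q = (THE l. l \<in> lines \<and> p \<in> l \<and> q \<in> l)"

lemma line: assumes "p \<noteq> q" shows "line p q \<in> lines" "p \<in> line p q" "q \<in> line p q"
  using theI'[OF line_unique[OF assms]] unfolding line_def by auto

lemma line_eq: "\<lbrakk>p \<noteq> q; l \<in> lines; p \<in> l; q \<in> l\<rbrakk> \<Longrightarrow> line p q = l"
  using line_unique[of p q] line[of p q] by blast

lemma line_subset: "\<lbrakk>proj_subspace lines X; p \<in> X; q \<in> X; p \<noteq> q\<rbrakk> \<Longrightarrow> line p q \<subseteq> X"
  by (meson line proj_subspaceD)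

text \<open>Inserting \<open>p\<close> makes \<open>join p {}\<close> equal to \<open>{p}\<close>,
  so a first basis point needs no special case. The union is meaningful for
  \<open>p \<notin> X\<close> only, as \<open>line p p\<close> is in general unspecified.\<close>

definition join :: "'p \<Rightarrow> 'p set \<Rightarrow> 'p set" where
  "join p X = insert p (\<Union>q\<in>X. line p q)"

lemma subset_join: "p \<notin> X \<Longrightarrow> X \<subseteq> join p X"
proof
  fix q assume "p \<notin> X" "q \<in> X"
  then have "q \<in> line p q" by (intro line) auto
  with \<open>q \<in> X\<close> show "q \<in> join p X" by (auto simp: join_def)
qed

lemma line_meets_once:
  assumes "proj_subspace lines X" "p \<notin> X" "q \<in> X" "q' \<in> X" "q' \<in> line p q"
  shows "q' = q"
proof (rule ccontr)
  assume "q' \<noteq> q"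
  moreover have "p \<noteq> q" using assms by auto
  ultimately have "line p q \<subseteq> X"
    using assms line[of p q] by (intro proj_subspaceD[of _ _ _ q q']) auto
  then show False using line(2)[OF \<open>p \<noteq> q\<close>] assms by auto
qed

text \<open>The lines \<open>line p q\<close> and \<open>l\<close> meet in \<open>x\<close>, so
  Veblen-Young forces \<open>line p z\<close> to meet \<open>line q r\<close>. The meeting point
  lies in \<open>X\<close>, and \<open>z\<close> is on its line to \<open>p\<close>.\<close>

lemma join_third_point:
  assumes X: "proj_subspace lines X" "p \<notin> X"
    and l: "l \<in> lines" "p \<notin> l" "r \<in> l" "r \<in> X" "z \<in> l"
    and x: "x \<in> l" "x \<notin> X" "x \<in> line p q" "q \<in> X"
  shows "z \<in> join p X"
proof -
  have pq: "p \<noteq> q" using x X by auto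
  consider "z \<in> X" | "z = x" | "z \<notin> X" "z \<noteq> x" by blast
  then show ?thesis
  proof cases
    case 1
    then have "z \<in> line p z" using X by (intro line) auto
    with 1 show ?thesis by (auto simp: join_def)
  next
    case 2
    then show ?thesis using x by (auto simp: join_def)
  next
    case 3
    have pz: "p \<noteq> z" using l by auto
    have xq: "x \<noteq> q" using x by auto
    have qr: "q \<noteq> r"
    proof
      assume "q = r"
      then have "l = line p q"
        using line_eq[of x q l] line_eq[of x q "line p q"] xq l x line[OF pq] by auto
      then show False using l line[OF pq] by auto
    qed
    have "line p z \<inter> line q r \<noteq> {}"
    proof (rule veblen_young[of p q z r "line p q" l])
      show "distinct [p, q, z, r]" using pz pq qr 3 l X x by auto
      show "line p q \<inter> l \<noteq> {}" using x by auto
    qed (use line[OF pq] line[OF pz] line[OF qr] l in auto)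
    then obtain s where s: "s \<in> line p z" "s \<in> line q r" by auto
    have sX: "s \<in> X" using line_subset[OF X(1) x(4) l(4) qr] s by auto
    then have "p \<noteq> s" using X by auto
    then have "line p s = line p z" using s line[OF pz] by (intro line_eq) auto
    then show ?thesis using sX line[OF pz] by (auto simp: join_def)
  qed
qed

lemma proj_subspace_join:
  assumes X: "proj_subspace lines X" "p \<notin> X"
  shows "proj_subspace lines (join p X)"
  unfolding proj_subspace_def
proof (intro ballI impI)
  fix l x y
  assume l: "l \<in> lines" and x: "x \<in> join p X \<inter> l" and y: "y \<in> join p X \<inter> l" and xy: "x \<noteq> y"
  have XU: "X \<subseteq> join p X" using X(2) by (rule subset_join)
  have through_p: "l \<subseteq> join p X" if w: "p \<in> l" "w \<in> join p X" "w \<in> l" "w \<noteq> p" for w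
  proof -
    obtain q where q: "q \<in> X" "w \<in> line p q" using w by (auto simp: join_def)
    have "p \<noteq> q" using q X by auto
    then have "line p w = line p q" using q w line[of p q] by (intro line_eq) auto
    moreover have "line p w = l" using w l by (intro line_eq) auto
    ultimately show ?thesis using q by (auto simp: join_def)
  qed
  show "l \<subseteq> join p X"
  proof (cases "p \<in> l")
    case True
    then show ?thesis using through_p[of x] through_p[of y] x y xy by auto
  next
    case pl: False
    then have "x \<noteq> p" "y \<noteq> p" using x y by auto
    then obtain q q' where q: "q \<in> X" "x \<in> line p q" and q': "q' \<in> X" "y \<in> line p q'"
      using x y by (auto simp: join_def)
    have pq: "p \<noteq> q" and pq': "p \<noteq> q'" using q q' X by auto
    have qq': "q \<noteq> q'"
    proof
      assume "q = q'"
      then have "line x y = line p q" using q q' xy line[OF pq] by (intro line_eq) auto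
      moreover have "line x y = l" using x y xy l by (intro line_eq) auto
      ultimately show False using pl line[OF pq] by auto
    qed
    show ?thesis
    proof (cases "x \<in> X \<and> y \<in> X")
      case True
      then have "l \<subseteq> X" using X l x y xy by (intro proj_subspaceD[of _ X l x y]) auto
      then show ?thesis using XU by auto
    next
      case notboth: False
      obtain r where r: "r \<in> l" "r \<in> X"
      proof (cases "x \<in> X \<or> y \<in> X")
        case True then show ?thesis using that x y by auto
      next
        case False
        \<comment> \<open>Here \<open>l\<close> joins points of two lines that meet in
          \<open>p\<close>, so it meets \<open>line q q'\<close>; this supplies the point of
          \<open>X\<close> on \<open>l\<close> that \<open>join_third_point\<close> needs.\<close>
        have "l \<inter> line q q' \<noteq> {}"
        proof (rule veblen_young[of x q y q' "line p q" "line p q'"])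
          show "distinct [x, q, y, q']" using False q q' qq' xy by auto
          show "line p q \<inter> line p q' \<noteq> {}" using line[OF pq] line[OF pq'] by auto
        qed (use line[OF pq] line[OF pq'] line[OF qq'] l x y q q' in auto)
        then show ?thesis using that line_subset[OF X(1) q(1) q'(1) qq'] by auto
      qed
      show ?thesis
      proof
        fix z assume z: "z \<in> l"
        show "z \<in> join p X"
        proof (cases "x \<in> X")
          case True
          then show ?thesis using join_third_point[OF X l pl r z, of y q'] notboth y q' by auto
        next
          case False
          then show ?thesis using join_third_point[OF X l pl r z, of x q] x q by auto
        qed
      qed
    qed
  qed
qed

lemma proj_span_insert_eq_join:
  assumes X: "proj_subspace lines X" "p \<notin> X"
  shows "proj_span lines (insert p X) = join p X"
proof
  have "X \<subseteq> join p X" using X(2) by (rule subset_join)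
  then show "proj_span lines (insert p X) \<subseteq> join p X"
    by (intro proj_span_minimal proj_subspace_join X) (auto simp: join_def)
  have "line p q \<subseteq> proj_span lines (insert p X)" if "q \<in> X" for q
    using that X proj_span_superset[of "insert p X" lines]
    by (intro line_subset proj_subspace_span) auto
  then show "join p X \<subseteq> proj_span lines (insert p X)"
    using proj_span_superset[of "insert p X" lines] by (auto simp: join_def)
qed

text \<open>By the join description, \<open>q\<close> is \<open>p\<close> or lies on a line from
  \<open>p\<close> to some \<open>r\<close> in the span of \<open>S\<close>. As
  \<open>q \<noteq> r\<close>, this line is also the one through \<open>q\<close> and
  \<open>r\<close>, and it leads back to \<open>p\<close>.\<close>

lemma proj_span_exchange:
  assumes q: "q \<in> proj_span lines (insert p S)" "q \<notin> proj_span lines S"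
  shows "p \<in> proj_span lines (insert q S)"
proof -
  let ?X = "proj_span lines S"
  have X: "proj_subspace lines ?X" by (rule proj_subspace_span)
  have pX: "p \<notin> ?X"
  proof
    assume "p \<in> ?X"
    then have "proj_span lines (insert p S) \<subseteq> ?X"
      using proj_span_superset[of S lines] by (intro proj_span_minimal X) auto
    then show False using q by auto
  qed
  have "q \<in> join p ?X"
    using q proj_span_insert_eq_join[OF X pX] by (simp add: proj_span_insert_span)
  then consider "q = p" | r where "r \<in> ?X" "q \<in> line p r" by (auto simp: join_def)
  then show ?thesis
  proof cases
    case 1 then show ?thesis using proj_span_superset[of "insert q S" lines] by auto
  next
    case (2 r)
    have pr: "p \<noteq> r" and qr: "q \<noteq> r" using 2 pX q by auto
    have "line q r = line p r" using 2 line[OF pr] qr by (intro line_eq) auto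
    then have "p \<in> line q r" using line[OF pr] by auto
    moreover have "line q r \<subseteq> proj_span lines (insert q ?X)"
      using 2 qr proj_span_superset[of "insert q ?X" lines]
      by (intro line_subset proj_subspace_span) auto
    ultimately show ?thesis by (auto simp: proj_span_insert_span)
  qed
qed

text \<open>If an old point became dependent with the help of \<open>p\<close>, exchange would put
  \<open>p\<close> into the span of \<open>B\<close>.\<close>

lemma proj_independent_insert:
  assumes B: "proj_independent lines B" and p: "p \<notin> proj_span lines B"
  shows "proj_independent lines (insert p B)"
  unfolding proj_independent_def
proof (intro ballI notI)
  have pB: "p \<notin> B" using p proj_span_superset[of B lines] by auto
  fix x assume x: "x \<in> insert p B" "x \<in> proj_span lines (insert p B - {x})"
  show False
  proof (cases "x = p")
    case True
    then show False using x p pB by simp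
  next
    case False
    then have xB: "x \<in> B" and eq: "insert p B - {x} = insert p (B - {x})" using x by auto
    have "x \<notin> proj_span lines (B - {x})" using B xB by (auto simp: proj_independent_def)
    moreover have "x \<in> proj_span lines (insert p (B - {x}))" using x(2) by (simp only: eq)
    from proj_span_exchange[OF this calculation] have "p \<in> proj_span lines (insert x (B - {x}))" .
    then show False using p xB by (simp add: insert_absorb)
  qed
qed

lemma extend_to_basis:
  assumes "proj_independent lines I" "I \<subseteq> X" "proj_subspace lines X"
  obtains B where "I \<subseteq> B" "proj_independent lines B" "proj_span lines B = X"
proof -
  define F where "F = {B. I \<subseteq> B \<and> B \<subseteq> X \<and> proj_independent lines B}"
  have "I \<in> F" using assms by (simp add: F_def)
  then have "finite F" "F \<noteq> {}" by auto
  from finite_has_maximal[OF this]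
  obtain B where B: "B \<in> F" and max: "\<forall>C\<in>F. B \<subseteq> C \<longrightarrow> B = C" by blast
  have "X \<subseteq> proj_span lines B"
  proof
    fix p assume p: "p \<in> X"
    show "p \<in> proj_span lines B"
    proof (rule ccontr)
      assume n: "p \<notin> proj_span lines B"
      then have "insert p B \<in> F" using B p proj_independent_insert by (simp add: F_def subset_insertI2)
      then have "B = insert p B" using max by blast
      then have "p \<in> B" by blast
      then show False using n proj_span_superset[of B lines] by blast
    qed
  qed
  then show ?thesis using that[of B] B proj_span_minimal[OF assms(3), of B] by (auto simp: F_def)
qed

end

section \<open>Cardinalities of subspaces\<close>

locale projective_space_of_order = projective_space +
  fixes n :: nat
  assumes order: "has_order lines n" and order_ge_2: "n \<ge> 2"
begin

text \<open>Size of a subspace with \<open>r\<close> basis points: the index is the projective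
  dimension plus one, and \<open>theta 0\<close> belongs to the empty subspace.\<close>

definition theta :: "nat \<Rightarrow> nat" where "theta r = (\<Sum>i<r. n ^ i)"

lemma theta_0 [simp]: "theta 0 = 0"
  and theta_Suc: "theta (Suc r) = 1 + n * theta r"
  and theta_Suc': "theta (Suc r) = theta r + n ^ r"
  unfolding theta_def by (simp, simp only: sum.lessThan_Suc_shift power_Suc sum_distrib_left power_0) simp

lemma theta_strict_mono: "strict_mono theta"
  using order_ge_2 by (intro strict_mono_Suc_iff[THEN iffD2]) (auto simp: theta_Suc')

lemma theta_less_iff [simp]: "theta r < theta s \<longleftrightarrow> r < s"
  and theta_eq_iff [simp]: "theta r = theta s \<longleftrightarrow> r = s"
  using theta_strict_mono by (simp_all add: strict_mono_less strict_mono_eq)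

lemma theta_diff: "r \<le> s \<Longrightarrow> theta s - theta r = n ^ r * theta (s - r)"
proof -
  assume "r \<le> s"
  have "theta (r + j) = theta r + n ^ r * theta j" for j
    by (induction j) (simp_all add: theta_Suc' power_add algebra_simps)
  from this[of "s - r"] \<open>r \<le> s\<close> show ?thesis by simp
qed

lemma card_line: "p \<noteq> q \<Longrightarrow> card (line p q) = n + 1"
  using order line[of p q] by (auto simp: has_order_def)

text \<open>Lines from \<open>p\<close> to different points of \<open>X\<close> share only
  \<open>p\<close>, since such a line meets \<open>X\<close> once; each contributes \<open>n\<close>
  further points.\<close>

lemma card_join:
  assumes X: "proj_subspace lines X" "p \<notin> X"
  shows "card (join p X) = 1 + n * card X"
proof -
  have ne: "p \<noteq> q" if "q \<in> X" for q using that X by auto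
  have "join p X = insert p (\<Union>q\<in>X. line p q - {p})" by (auto simp: join_def)
  also have "card \<dots> = 1 + card (\<Union>q\<in>X. line p q - {p})"
    by (subst card_insert_disjoint) auto
  also have "card (\<Union>q\<in>X. line p q - {p}) = (\<Sum>q\<in>X. card (line p q - {p}))"
  proof (intro card_UN_disjoint ballI impI)
    fix q q' assume q: "q \<in> X" "q' \<in> X" "q \<noteq> q'"
    show "(line p q - {p}) \<inter> (line p q' - {p}) = {}"
    proof (rule ccontr)
      assume "(line p q - {p}) \<inter> (line p q' - {p}) \<noteq> {}"
      then obtain z where "z \<in> line p q" "z \<in> line p q'" "z \<noteq> p" by auto
      then have "line p q = line p q'"
        using line_eq[of p z] line[OF ne[OF q(1)]] line[OF ne[OF q(2)]] by metis
      then show False using line_meets_once[OF X q(1,2)] line[OF ne[OF q(2)]] q by auto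
    qed
  qed auto
  also have "\<dots> = (\<Sum>q\<in>X. n)"
    using ne line card_line by (intro sum.cong) auto
  finally show ?thesis by simp
qed

lemma card_span_independent:
  assumes "proj_independent lines B"
  shows "card (proj_span lines B) = theta (card B)"
proof -
  have "finite B" by simp
  then show ?thesis using assms
  proof (induction B)
    case empty
    have "proj_span lines {} \<subseteq> {}" by (rule proj_span_minimal) (auto simp: proj_subspace_def)
    then show ?case by simp
  next
    case (insert p B)
    let ?X = "proj_span lines B"
    have "p \<notin> ?X" using insert by (auto simp: proj_independent_def)
    then have "card (proj_span lines (insert p B)) = 1 + n * card ?X"
      using card_join proj_span_insert_eq_join proj_subspace_span proj_span_insert_span by metis
    then show ?case
      using insert proj_independent_subset[OF insert.prems, of B] by (auto simp: theta_Suc)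
  qed
qed

lemma subspace_has_basis:
  assumes "proj_subspace lines X"
  obtains B where "proj_independent lines B" "proj_span lines B = X" "card X = theta (card B)"
  using extend_to_basis[of "{}" X] assms card_span_independent
  by (metis empty_subsetI equals0D proj_independent_def)

lemma has_proj_dim_iff_card:
  assumes "proj_subspace lines X"
  shows "has_proj_dim lines X k \<longleftrightarrow> card X = theta (k + 1)"
proof
  show "has_proj_dim lines X k \<Longrightarrow> card X = theta (k + 1)"
    using card_span_independent by (auto simp: has_proj_dim_def)
  assume "card X = theta (k + 1)"
  with subspace_has_basis[OF assms] show "has_proj_dim lines X k"
    unfolding has_proj_dim_def by (metis theta_eq_iff)
qed

end

section \<open>Counting hyperplanes\<close>

locale finite_projective_space = projective_space_of_order +
  fixes d :: nat
  assumes dim: "has_proj_dim lines UNIV d" and dim_pos: "d \<ge> 1"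
begin

lemma card_points: "CARD('a) = theta (d + 1)"
  using dim has_proj_dim_iff_card[OF proj_subspace_UNIV] by simp

lemma hyperplanes_iff: "H \<in> hyperplanes lines d \<longleftrightarrow> proj_subspace lines H \<and> card H = theta d"
  using has_proj_dim_iff_card[of H "d - 1"] dim_pos by (auto simp: hyperplanes_def)

text \<open>Induction on the codimension. With \<open>m = d - r\<close>, pairs of a hyperplane
  \<open>H \<supseteq> X\<close> and a point of \<open>H - X\<close> are counted twice: each
  \<open>H\<close> has \<open>n ^ r * theta m\<close> such points, and each
  \<open>p \<notin> X\<close> lies on \<open>theta m\<close> such hyperplanes by induction for the
  span of \<open>insert p X\<close>.\<close>

lemma card_hyperplanes_containing:
  assumes "proj_subspace lines X" "card X = theta r" "r \<le> d + 1"
  shows "card {H \<in> hyperplanes lines d. X \<subseteq> H} = theta (d + 1 - r)"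
  using assms
proof (induction "d + 1 - r" arbitrary: X r)
  case 0
  then have r: "r = d + 1" by simp
  have "X \<subseteq> H \<Longrightarrow> card H \<noteq> theta d" for H
    using card_mono[of H X] 0 r by (auto dest: leD)
  then have "{H \<in> hyperplanes lines d. X \<subseteq> H} = {}" by (auto simp: hyperplanes_iff)
  then show ?case using r by (metis card.empty diff_self_eq_0 theta_0)
next
  case (Suc m)
  show ?case
  \<comment> \<open>The case \<open>r = d\<close> is separate because \<open>theta 0 = 0\<close>
    cannot be cancelled from the double count.\<close>
  proof (cases "m = 0")
    case True
    then have r: "r = d" using Suc by simp
    have "{H \<in> hyperplanes lines d. X \<subseteq> H} = {X}"
      using Suc.prems r by (auto simp: hyperplanes_iff dest: card_subset_eq[OF finite])
    then show ?thesis using r by (simp add: theta_Suc)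
  next
    case False
    let ?S = "{H \<in> hyperplanes lines d. X \<subseteq> H}"
    have rd: "r < d" and m: "m = d - r" using Suc False by auto
    have up: "card {H \<in> ?S. p \<in> H} = theta m" if p: "p \<notin> X" for p
    proof -
      let ?Y = "proj_span lines (insert p X)"
      have Y: "card ?Y = theta (r + 1)"
        using card_join[OF Suc.prems(1) p] proj_span_insert_eq_join[OF Suc.prems(1) p] Suc.prems
        by (simp add: theta_Suc)
      have "{H \<in> ?S. p \<in> H} = {H \<in> hyperplanes lines d. ?Y \<subseteq> H}"
        using proj_span_superset[of "insert p X" lines] proj_span_minimal[of lines _ "insert p X"]
        by (auto simp: hyperplanes_iff)
      then show ?thesis
        using Suc.hyps(1)[OF _ proj_subspace_span Y] rd m by auto
    qed
    have down: "card (H - X) = n ^ r * theta m" if "H \<in> ?S" for H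
      using that Suc.prems rd m theta_diff[of r d]
      by (auto simp: hyperplanes_iff card_Diff_subset)
    have "card ?S * (n ^ r * theta m) = (\<Sum>H\<in>?S. card (H - X))"
      using down by simp
    also have "\<dots> = (\<Sum>H\<in>?S. \<Sum>p\<in>- X. if p \<in> H then 1 else 0)"
      by (intro sum.cong) (auto simp: sum.If_cases intro!: arg_cong[where f = card])
    also have "\<dots> = (\<Sum>p\<in>- X. \<Sum>H\<in>?S. if p \<in> H then 1 else 0)"
      by (rule sum.swap)
    also have "\<dots> = (\<Sum>p\<in>- X. card {H \<in> ?S. p \<in> H})"
      by (intro sum.cong) (auto simp: sum.If_cases intro!: arg_cong[where f = card])
    also have "\<dots> = card (- X) * theta m" using up by simp
    also have "card (- X) = n ^ r * theta (d + 1 - r)"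
      using card_points Suc.prems theta_diff[of r "d + 1"]
      by (simp add: Compl_eq_Diff_UNIV card_Diff_subset)
    finally have "(card ?S * n ^ r) * theta m = (theta (d + 1 - r) * n ^ r) * theta m"
      by (simp add: mult_ac)
    moreover have "theta m \<noteq> 0" "n ^ r \<noteq> 0"
      using False theta_less_iff[of 0 m] order_ge_2 by auto
    ultimately show ?thesis by (metis mult_right_cancel)
  qed
qed

lemma card_hyperplanes: "card (hyperplanes lines d) = theta (d + 1)"
  using card_hyperplanes_containing[of "{}" 0] by (simp add: proj_subspace_def)

lemma card_hyperplanes_point: "card {H \<in> hyperplanes lines d. p \<in> H} = theta d"
  using card_hyperplanes_containing[of "{p}" 1] by (simp add: proj_subspace_def theta_Suc)

lemma card_hyperplanes_two_points:
  assumes "p \<noteq> q"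
  shows "card {H \<in> hyperplanes lines d. p \<in> H \<and> q \<in> H} = theta (d - 1)"
proof -
  have sub: "proj_subspace lines {q}" by (simp add: proj_subspace_def)
  have "{H \<in> hyperplanes lines d. p \<in> H \<and> q \<in> H}
      = {H \<in> hyperplanes lines d. proj_span lines {p, q} \<subseteq> H}"
    using proj_span_superset[of "{p, q}" lines] proj_span_minimal[of lines _ "{p, q}"]
    by (auto simp: hyperplanes_iff)
  moreover have "card (proj_span lines {p, q}) = theta 2"
    using card_join[OF sub] proj_span_insert_eq_join[OF sub] assms
    by (simp add: numeral_2_eq_2 theta_Suc)
  ultimately show ?thesis
    using card_hyperplanes_containing[OF proj_subspace_span, of "{p, q}" 2] dim_pos by simp
qed

section \<open>The VC dimension\<close>

lemma card_shattered_le: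
  assumes "bij_betw hyp UNIV (hyperplanes lines d)" "shattered (signed_incidence hyp) C"
  shows "card C \<le> d"
proof -
  have hyp: "proj_subspace lines (hyp h)" for h
    using assms(1) bij_betwE hyperplanes_iff by blast
  have pattern: "\<exists>p. \<forall>h\<in>C. p \<in> hyp h \<longleftrightarrow> h \<in> T" for T
  proof -
    have "\<exists>p. \<forall>h\<in>C. signed_incidence hyp $ p $ h = (if h \<in> T then 1 else -1)"
      using assms(2) unfolding shattered_def by (auto dest: spec[of _ "\<lambda>h. if h \<in> T then 1 else -1"])
    then show ?thesis by (simp add: signed_incidence_def split: if_splits) (metis one_neq_neg_one)
  qed
  have step: "\<exists>r. card (\<Inter>h\<in>T. hyp h) = theta r \<and> r + card T \<le> d + 1" if "T \<subseteq> C" for T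
  proof -
    have "finite T" by simp
    then show ?thesis using that
    proof (induction T)
      case empty then show ?case using card_points by auto
    next
      case (insert h T)
      then obtain r where r: "card (\<Inter>h\<in>T. hyp h) = theta r" "r + card T \<le> d + 1" by auto
      have "proj_subspace lines (\<Inter>h\<in>insert h T. hyp h)"
        using hyp by (intro proj_subspace_Inter) auto
      then obtain s where s: "card (\<Inter>h\<in>insert h T. hyp h) = theta s"
        by (metis subspace_has_basis)
      \<comment> \<open>The point with pattern \<open>T\<close> lies on every hyperplane of
        \<open>T\<close> but not on \<open>hyp h\<close>, so the new intersection is strictly
        smaller.\<close>
      obtain p where "\<forall>h\<in>C. p \<in> hyp h \<longleftrightarrow> h \<in> T" using pattern by blast
      then have "p \<in> (\<Inter>h\<in>T. hyp h)" "p \<notin> (\<Inter>h\<in>insert h T. hyp h)"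
        using insert by auto
      then have "(\<Inter>h\<in>insert h T. hyp h) \<subset> (\<Inter>h\<in>T. hyp h)" by auto
      then have "theta s < theta r"
        using psubset_card_mono[OF finite] r s by metis
      then show ?case using s r insert by auto
    qed
  qed
  obtain r where r: "card (\<Inter>h\<in>C. hyp h) = theta r" "r + card C \<le> d + 1"
    using step[of C] by auto
  \<comment> \<open>The pattern with all signs \<open>1\<close> makes the whole intersection
    nonempty, so \<open>r \<ge> 1\<close>; this improves \<open>d + 1\<close> to
    \<open>d\<close>.\<close>
  obtain p where "p \<in> (\<Inter>h\<in>C. hyp h)" using pattern[of C] by auto
  then have "card (\<Inter>h\<in>C. hyp h) > 0" by (auto simp: card_gt_0_iff)
  then have "r \<noteq> 0" using r by (metis less_irrefl theta_0)
  then show ?thesis using r by simp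
qed

text \<open>The synthetic form of a point with no zero coordinate relative to \<open>I\<close>.
  Since non-Desarguesian planes have no coordinates over a field, it is built by induction, using
  that lines have at least three points.\<close>

lemma full_support_point:
  assumes "proj_independent lines I" "I \<noteq> {}"
  shows "\<exists>q \<in> proj_span lines I. \<forall>x\<in>I. q \<notin> proj_span lines (I - {x})"
proof -
  have "finite I" by simp
  then show ?thesis using assms(2,1)
  proof (induction I rule: finite_ne_induct)
    case (singleton p)
    have "proj_span lines {} \<subseteq> {}" by (rule proj_span_minimal) (auto simp: proj_subspace_def)
    then show ?case using proj_span_superset[of "{p}" lines] by auto
  next
    case (insert p I)
    obtain q where q: "q \<in> proj_span lines I" "\<And>x. x \<in> I \<Longrightarrow> q \<notin> proj_span lines (I - {x})"
      using insert proj_independent_subset[of lines "insert p I" I] by blast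
    have pI: "p \<notin> proj_span lines I"
      using insert by (auto simp: proj_independent_def)
    then have pq: "p \<noteq> q" using q by auto
    \<comment> \<open>A third point of the line joining \<open>p\<close> to \<open>q\<close> has full support.\<close>
    have "card (line p q - {p, q}) = n - 1"
      using card_line[OF pq] line[OF pq] pq by (simp add: card_Diff_subset)
    then have "line p q - {p, q} \<noteq> {}"
      using order_ge_2 by (metis card.empty diff_is_0_eq not_less_eq_eq numeral_2_eq_2 One_nat_def)
    then obtain r where r: "r \<in> line p q" "r \<noteq> p" "r \<noteq> q" by auto
    have in_sub: "p \<in> X" if "proj_subspace lines X" "q \<in> X" "r \<in> X" for X
      using proj_subspaceD[OF that(1) line(1)[OF pq] that(2,3)] r line[OF pq] by auto
    have in_sub': "q \<in> X" if "proj_subspace lines X" "p \<in> X" "r \<in> X" for X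
      using proj_subspaceD[OF that(1) line(1)[OF pq] that(2,3)] r line[OF pq] by auto
    have "proj_span lines I \<subseteq> proj_span lines (insert p I)" by (rule proj_span_mono) auto
    then have "line p q \<subseteq> proj_span lines (insert p I)"
      using proj_span_superset[of "insert p I" lines] q pq
      by (intro line_subset proj_subspace_span) auto
    moreover have "r \<notin> proj_span lines (insert p I - {x})" if x: "x \<in> insert p I" for x
    proof (cases "x = p")
      case True
      then show ?thesis using in_sub[OF proj_subspace_span[of lines I]] q pI insert(3) by auto
    next
      case False
      then have xI: "x \<in> I" and eq: "insert p I - {x} = insert p (I - {x})" using x by auto
      show ?thesis
      proof
        assume "r \<in> proj_span lines (insert p I - {x})"
        \<comment> \<open>The line through \<open>p\<close> and \<open>r\<close> contains
          \<open>q\<close>; exchanging \<open>q\<close> against \<open>p\<close> would then put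
          \<open>p\<close> into the span of \<open>I\<close>.\<close>
        then have "q \<in> proj_span lines (insert p (I - {x}))"
          using in_sub'[OF proj_subspace_span[of lines "insert p (I - {x})"]]
            proj_span_superset[of "insert p (I - {x})" lines] unfolding eq by auto
        then have "p \<in> proj_span lines (insert q (I - {x}))"
          using q(2)[OF xI] by (rule proj_span_exchange)
        moreover have "proj_span lines (insert q (I - {x})) \<subseteq> proj_span lines I"
          using q proj_span_superset[of I lines] by (intro proj_span_minimal proj_subspace_span) auto
        ultimately show False using pI by auto
      qed
    qed
    ultimately show ?case using r by blast
  qed
qed

text \<open>The hyperplane \<open>H x\<close> opposite to a basis point \<open>x\<close> contains
  all other basis points. A point of full support on \<open>I\<close> avoids \<open>H x\<close>
  exactly for \<open>x \<in> I\<close>, so \<open>I\<close> encodes the wanted pattern.\<close>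

lemma ex_shattered_card_eq_dim:
  assumes hyp: "bij_betw hyp UNIV (hyperplanes lines d)"
  shows "\<exists>C. shattered (signed_incidence hyp) C \<and> card C = d"
proof -
  obtain B where B: "proj_independent lines B" "proj_span lines B = UNIV" "card B = d + 1"
    using dim by (auto simp: has_proj_dim_def)
  then obtain b where b: "b \<in> B" by fastforce
  define H where "H x = proj_span lines (B - {x})" for x
  have "H x \<in> hyperplanes lines d" if "x \<in> B" for x
    unfolding H_def hyperplanes_iff
    using card_span_independent[OF proj_independent_subset[OF B(1), of "B - {x}"]] that B
    by (auto simp: proj_subspace_span)
  then have "\<exists>h. hyp h = H x" if "x \<in> B" for x
    using that hyp by (metis bij_betw_imp_surj_on imageE)
  then obtain g where g: "\<And>x. x \<in> B \<Longrightarrow> hyp (g x) = H x" by metis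
  have xH: "x \<notin> H x" if "x \<in> B" for x
    using that B by (auto simp: H_def proj_independent_def)
  have yH: "y \<in> H x" if "x \<in> B" "y \<in> B" "x \<noteq> y" for x y
    using that proj_span_superset[of "B - {x}" lines] by (auto simp: H_def)
  have inj: "inj_on g B"
    by (rule inj_onI) (metis g xH yH)
  let ?C = "g ` (B - {b})"
  have "card ?C = d"
    using inj B b by (simp add: card_image inj_on_diff)
  moreover have "shattered (signed_incidence hyp) ?C"
    unfolding shattered_def
  proof (intro allI impI)
    fix f :: "'b \<Rightarrow> real" assume f: "\<forall>j\<in>?C. f j \<in> {-1, 1}"
    \<comment> \<open>Including \<open>b\<close> keeps \<open>I\<close> nonempty even when all
      prescribed signs are \<open>1\<close>; for this the hyperplane opposite to \<open>b\<close> is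
      left out of \<open>?C\<close>.\<close>
    define I where "I = {x \<in> B. x = b \<or> f (g x) = -1}"
    have "I \<subseteq> B" "I \<noteq> {}" using b by (auto simp: I_def)
    then obtain q where q: "q \<in> proj_span lines I" "\<And>x. x \<in> I \<Longrightarrow> q \<notin> proj_span lines (I - {x})"
      using full_support_point[of I] proj_independent_subset[OF B(1)] by blast
    have "signed_incidence hyp $ q $ g x = f (g x)" if x: "x \<in> B" "x \<noteq> b" for x
    proof (cases "x \<in> I")
      case False
      then have "I \<subseteq> B - {x}" "f (g x) = 1" using x f by (auto simp: I_def)
      then have "q \<in> H x" using q proj_span_mono[of I "B - {x}" lines] by (auto simp: H_def)
      then show ?thesis using \<open>f (g x) = 1\<close> x g by (simp add: signed_incidence_def)
    next
      case True
      have "q \<notin> H x"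
      proof
        assume qH: "q \<in> H x"
        have eq: "insert x (I - {x}) = I" using True by auto
        have "x \<in> proj_span lines (insert q (I - {x}))"
          using proj_span_exchange[OF _ q(2)[OF True], of x] q(1) by (simp only: eq)
        also have "\<dots> \<subseteq> H x"
          using qH \<open>I \<subseteq> B\<close> proj_span_superset[of "B - {x}" lines] unfolding H_def
          by (intro proj_span_minimal proj_subspace_span) auto
        finally show False using xH x by auto
      qed
      then show ?thesis using True x g by (simp add: signed_incidence_def I_def)
    qed
    then show "\<exists>i. \<forall>j\<in>?C. signed_incidence hyp $ i $ j = f j" by auto
  qed
  ultimately show ?thesis by blast
qed

lemma vc_dim_signed_incidence:
  assumes "bij_betw hyp UNIV (hyperplanes lines d)"
  shows "vc_dim (signed_incidence hyp) = d"
  unfolding vc_dim_def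
proof (rule Max_eqI)
  show "finite {card C |C. shattered (signed_incidence hyp) C}" by simp
  show "y \<le> d" if "y \<in> {card C |C. shattered (signed_incidence hyp) C}" for y
    using that card_shattered_le[OF assms] by auto
  show "d \<in> {card C |C. shattered (signed_incidence hyp) C}"
    using ex_shattered_card_eq_dim[OF assms] by auto
qed

end

section \<open>Forster's bound\<close>

text \<open>A crude Hadamard inequality read off the Leibniz formula. The factorial is harmless, as
  only some positive constant is needed later.\<close>

lemma abs_det_le_prod_norm:
  fixes A :: "real^'m^'m"
  shows "\<bar>det A\<bar> \<le> fact CARD('m) * (\<Prod>i\<in>UNIV. norm (A $ i))"
proof -
  have "\<bar>det A\<bar> \<le> (\<Sum>p | p permutes (UNIV :: 'm set). \<bar>of_int (sign p) * (\<Prod>i\<in>UNIV. A $ i $ p i)\<bar>)"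
    unfolding det_def by (rule sum_abs)
  also have "\<dots> \<le> (\<Sum>p | p permutes (UNIV :: 'm set). (\<Prod>i\<in>UNIV. norm (A $ i)))"
    by (intro sum_mono)
      (auto simp: abs_mult sign_def abs_prod intro!: prod_mono component_le_norm_cart)
  also have "\<dots> = fact CARD('m) * (\<Prod>i\<in>UNIV. norm (A $ i))"
    by (simp add: card_permutations)
  finally show ?thesis .
qed

text \<open>With the basis as rows of \<open>X\<close>, the rows of \<open>X ** transpose B\<close>
  are the images \<open>B *v e\<close>, and \<open>c\<close> depends on the basis but not on
  \<open>B\<close>.\<close>

lemma abs_det_le_basis:
  fixes E :: "(real^'m) set"
  assumes "independent E" "card E = CARD('m)"
  obtains c where "c > 0" "\<And>B :: real^'m^'m. \<bar>det B\<bar> \<le> c * (\<Prod>e\<in>E. norm (B *v e))"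
proof -
  obtain f where f: "bij_betw f (UNIV :: 'm set) E"
    using assms by (metis finite_class.finite_UNIV finite_same_card_bij finiteI_independent)
  define X :: "real^'m^'m" where "X = (\<chi> i. f i)"
  have "rows X = E"
    using f by (auto simp: rows_def row_def X_def bij_betw_def)
  then have "rank X = CARD('m)"
    using assms by (simp add: row_rank_def dim_eq_card_independent)
  then have X: "det X \<noteq> 0" by (simp add: det_eq_0_rank)
  show ?thesis
  proof
    show "fact CARD('m) / \<bar>det X\<bar> > 0" using X by simp
    fix B :: "real^'m^'m"
    let ?Y = "X ** transpose B"
    have row: "?Y $ i = B *v f i" for i
      by (simp add: vec_eq_iff matrix_matrix_mult_def matrix_vector_mult_def transpose_def X_def mult.commute)
    have "\<bar>det X\<bar> * \<bar>det B\<bar> = \<bar>det ?Y\<bar>" by (simp add: det_mul abs_mult)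
    also have "\<dots> \<le> fact CARD('m) * (\<Prod>i\<in>UNIV. norm (B *v f i))"
      using abs_det_le_prod_norm[of ?Y] by (simp add: row)
    also have "(\<Prod>i\<in>UNIV. norm (B *v f i)) = (\<Prod>e\<in>E. norm (B *v e))"
      using f by (rule prod.reindex_bij_betw)
    finally show "\<bar>det B\<bar> \<le> fact CARD('m) / \<bar>det X\<bar> * (\<Prod>e\<in>E. norm (B *v e))"
      using X by (simp add: field_simps)
  qed
qed

text \<open>\<open>E\<close> is completed by an orthonormal basis of the complement of
  \<open>V\<close>. As \<open>B\<close> fixes these vectors, their factors are \<open>1\<close> and
  drop out.\<close>

lemma abs_det_le_subspace_basis:
  fixes V :: "(real^'m) set"
  assumes V: "subspace V" and E: "independent E" "E \<subseteq> V" "card E = dim V"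
  obtains c where "c > 0" "\<And>B :: real^'m^'m. (\<forall>w\<in>V\<^sup>\<bottom>. B *v w = w) \<Longrightarrow>
    \<bar>det B\<bar> \<le> c * (\<Prod>e\<in>E. norm (B *v e))"
proof -
  obtain W where W: "W \<subseteq> V\<^sup>\<bottom>" "\<And>w. w \<in> W \<Longrightarrow> norm w = 1" "independent W"
      "card W = dim (V\<^sup>\<bottom>)" "span W = V\<^sup>\<bottom>"
    using orthonormal_basis_subspace[OF subspace_orthogonal_comp[of V]] by metis
  have fin: "finite E" "finite W" using E W by (auto intro: finiteI_independent)
  have spanE: "span E = V"
    using E V by (metis card_eq_dim fin(1) span_eq_iff order.antisym span_minimal)
  have disj: "E \<inter> W = {}"
  proof (rule ccontr)
    assume "E \<inter> W \<noteq> {}"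
    then obtain e where "e \<in> W" "e \<in> V \<inter> V\<^sup>\<bottom>" using E W by blast
    then have "e = 0" using orthogonal_Int_0[OF V] by blast
    then show False using W(2)[OF \<open>e \<in> W\<close>] by simp
  qed
  have dims: "card (E \<union> W) = CARD('m)"
  proof -
    have "dim V + dim (V\<^sup>\<bottom>) = DIM(real^'m)"
      using dim_subspace_orthogonal_to_vectors[of V UNIV] V
      by (simp add: orthogonal_comp_def orthogonal_commute)
    then show ?thesis using card_Un_disjoint[OF fin disj] E W by simp
  qed
  have "V + V\<^sup>\<bottom> \<subseteq> span (E \<union> W)"
    by (intro subspace_sum_minimal subspace_span) (use span_mono[of E "E \<union> W"] span_mono[of W "E \<union> W"] spanE W(5) in auto)
  then have "independent (E \<union> W)"
    using subspace_sum_orthogonal_comp[OF V] fin dims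
    by (intro card_le_dim_spanning[of _ UNIV]) auto
  then obtain c where c: "c > 0" "\<And>B :: real^'m^'m. \<bar>det B\<bar> \<le> c * (\<Prod>e\<in>E \<union> W. norm (B *v e))"
    using abs_det_le_basis dims by blast
  have "(\<Prod>e\<in>E \<union> W. norm (B *v e)) = (\<Prod>e\<in>E. norm (B *v e))"
    if "\<forall>w\<in>V\<^sup>\<bottom>. B *v w = w" for B :: "real^'m^'m"
  proof -
    have "(\<Prod>e\<in>W. norm (B *v e)) = 1" using that W by (intro prod.neutral) auto
    then show ?thesis by (simp add: prod.union_disjoint[OF fin disj])
  qed
  then show ?thesis using c by (intro that[of c]) metis+
qed

lemma card_subsets_containing:
  fixes s :: "'p::finite"
  assumes "k \<ge> 1"
  shows "card {S. card S = k \<and> s \<in> S} = (CARD('p) - 1) choose (k - 1)"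
proof -
  have "{S. card S = k \<and> s \<in> S} = insert s ` {T. T \<subseteq> UNIV - {s} \<and> card T = k - 1}"
  proof (intro equalityI subsetI)
    fix S assume "S \<in> {S. card S = k \<and> s \<in> S}"
    then have "S = insert s (S - {s})" "card (S - {s}) = k - 1" by auto
    then show "S \<in> insert s ` {T. T \<subseteq> UNIV - {s} \<and> card T = k - 1}" by blast
  next
    fix S assume "S \<in> insert s ` {T. T \<subseteq> UNIV - {s} \<and> card T = k - 1}"
    then obtain T where T: "S = insert s T" "s \<notin> T" "card T = k - 1" by auto
    then show "S \<in> {S. card S = k \<and> s \<in> S}" using assms by (simp add: card_insert_disjoint)
  qed
  moreover have "inj_on (insert s) {T. T \<subseteq> UNIV - {s} \<and> card T = k - 1}"
    by (rule inj_onI) auto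
  ultimately show ?thesis
    using n_subsets[of "UNIV - {s}" "k - 1"] by (simp add: card_image)
qed

lemma prod_over_subsets:
  fixes g :: "'p::finite \<Rightarrow> 'a::comm_semiring_1"
  assumes "k \<ge> 1"
  shows "(\<Prod>S | card S = k. \<Prod>s\<in>S. g s) = (\<Prod>s\<in>UNIV. g s) ^ ((CARD('p) - 1) choose (k - 1))"
proof -
  have "(\<Prod>S | card S = k. \<Prod>s\<in>S. g s) = (\<Prod>S | card S = k. \<Prod>s\<in>UNIV. if s \<in> S then g s else 1)"
    by (rule prod.cong) (simp_all add: prod.If_cases)
  also have "\<dots> = (\<Prod>s\<in>UNIV. \<Prod>S | card S = k. if s \<in> S then g s else 1)"
    by (rule prod.swap)
  also have "\<dots> = (\<Prod>s\<in>UNIV. g s ^ card {S. card S = k \<and> s \<in> S})"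
    by (intro prod.cong) (auto simp: prod.If_cases Int_def)
  finally show ?thesis
    by (simp only: card_subsets_containing[OF assms] prod_power_distrib)
qed

text \<open>The matrix I + t v v^T; for a unit vector \<open>v\<close> it stretches \<open>v\<close>
  by \<open>1 + t\<close> and fixes the orthogonal complement of \<open>v\<close>.\<close>

definition rank_one_update :: "real \<Rightarrow> real^'m \<Rightarrow> real^'m^'m" where
  "rank_one_update t v = mat 1 + (\<chi> i j. t * v $ i * v $ j)"

lemma rank_one_update_mult:
  "rank_one_update t v *v y = y + (t * (v \<bullet> y)) *\<^sub>R v"
proof -
  have "(\<chi> i j. t * v $ i * v $ j) *v y = (t * (v \<bullet> y)) *\<^sub>R v"
    by (simp add: vec_eq_iff matrix_vector_mult_def inner_vec_def sum_distrib_left mult_ac)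
  then show ?thesis
    by (simp add: rank_one_update_def matrix_vector_mult_add_rdistrib)
qed

text \<open>Conjugation by an orthogonal matrix that sends a coordinate vector to \<open>v\<close>
  makes the update diagonal.\<close>

lemma det_rank_one_update:
  fixes v :: "real^'m"
  assumes "norm v = 1"
  shows "det (rank_one_update t v) = 1 + t"
proof -
  fix k :: 'm
  obtain A where A: "orthogonal_matrix A" "A *v (axis k 1) = v"
    using orthogonal_matrix_exists_basis[OF assms] by metis
  define D :: "real^'m^'m" where "D = (\<chi> i j. if i = j then (if i = k then 1 + t else 1) else 0)"
  have "(D *v z) $ i = (\<Sum>j\<in>UNIV. if i = j then (if i = k then 1 + t else 1) * z $ j else 0)" for z i
    by (simp only: D_def matrix_vector_mult_def vec_lambda_beta, rule sum.cong) auto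
  then have "(D *v z) $ i = (if i = k then 1 + t else 1) * z $ i" for z i
    by simp
  then have D: "D *v z = z + (t * z $ k) *\<^sub>R axis k 1" for z
    by (simp add: vec_eq_iff axis_def algebra_simps)
  have "rank_one_update t v = A ** D ** transpose A"
  proof (subst matrix_eq, intro allI)
    fix y
    have "(transpose A *v y) $ k = v \<bullet> y"
      using A(2) by (metis cart_eq_inner_axis dot_lmul_matrix inner_commute transpose_matrix_vector)
    moreover have "A *v (transpose A *v y) = y"
      using A(1) by (simp add: matrix_vector_mul_assoc orthogonal_matrix_def del: transpose_matrix_vector)
    ultimately show "rank_one_update t v *v y = A ** D ** transpose A *v y"
      by (simp add: rank_one_update_mult D A(2) matrix_vector_right_distrib matrix_vector_mult_scaleR
        del: transpose_matrix_vector flip: matrix_vector_mul_assoc)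
  qed
  moreover have "det D = 1 + t"
    by (subst det_diagonal) (auto simp: D_def)
  moreover have "det A * det A = 1"
    using det_orthogonal_matrix[OF A(1)] by auto
  ultimately show ?thesis by (simp add: det_mul mult.commute mult.left_commute)
qed

text \<open>General position makes every \<open>k\<close>-subset of the points a basis of
  \<open>V\<close>. The determinant bounds are multiplied over all these subsets; each point occurs
  in \<open>(CARD('p) - 1) choose (k - 1)\<close> of them.\<close>

lemma potential_bounded_below:
  fixes x :: "'p::finite \<Rightarrow> real^'m"
  assumes V: "subspace V" and xV: "\<And>p. x p \<in> V" and k: "k = dim V" "k \<ge> 1"
    and gen: "\<And>S. card S \<le> k \<Longrightarrow> inj_on x S \<and> independent (x ` S)"
  obtains C where "C > 0" "\<And>B :: real^'m^'m. (\<forall>w\<in>V\<^sup>\<bottom>. B *v w = w) \<Longrightarrow>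
    \<bar>det B\<bar> ^ (CARD('p) choose k) \<le> C * (\<Prod>p\<in>UNIV. norm (B *v x p)) ^ ((CARD('p) - 1) choose (k - 1))"
proof -
  have "\<exists>c>0. \<forall>B :: real^'m^'m. (\<forall>w\<in>V\<^sup>\<bottom>. B *v w = w) \<longrightarrow> \<bar>det B\<bar> \<le> c * (\<Prod>s\<in>S. norm (B *v x s))"
    if "card S = k" for S
  proof -
    have S: "inj_on x S" "independent (x ` S)" using gen[of S] that by auto
    have "card (x ` S) = dim V" using S k that by (simp add: card_image)
    then obtain c where "c > 0" "\<And>B :: real^'m^'m. (\<forall>w\<in>V\<^sup>\<bottom>. B *v w = w) \<Longrightarrow>
        \<bar>det B\<bar> \<le> c * (\<Prod>e\<in>x ` S. norm (B *v e))"
      using abs_det_le_subspace_basis[OF V S(2)] xV by blast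
    then show ?thesis by (intro exI[of _ c]) (simp add: prod.reindex[OF S(1)])
  qed
  then obtain c where c: "\<And>S. card S = k \<Longrightarrow> c S > 0"
    "\<And>S B. card S = k \<Longrightarrow> (\<forall>w\<in>V\<^sup>\<bottom>. B *v w = w) \<Longrightarrow> \<bar>det (B :: real^'m^'m)\<bar> \<le> c S * (\<Prod>s\<in>S. norm (B *v x s))"
    by metis
  have card: "card {S :: 'p set. card S = k} = CARD('p) choose k"
    using n_subsets[of "UNIV :: 'p set" k] by simp
  show ?thesis
  proof
    show "(\<Prod>S | card S = k. c S) > 0" using c by (intro prod_pos) auto
    fix B :: "real^'m^'m" assume B: "\<forall>w\<in>V\<^sup>\<bottom>. B *v w = w"
    have "\<bar>det B\<bar> ^ (CARD('p) choose k) = (\<Prod>S :: 'p set | card S = k. \<bar>det B\<bar>)"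
      by (simp add: card)
    also have "\<dots> \<le> (\<Prod>S | card S = k. c S * (\<Prod>s\<in>S. norm (B *v x s)))"
      using c B by (intro prod_mono) auto
    also have "\<dots> = (\<Prod>S | card S = k. c S) * (\<Prod>p\<in>UNIV. norm (B *v x p)) ^ ((CARD('p) - 1) choose (k - 1))"
      by (simp add: prod.distrib prod_over_subsets[OF k(2)])
    finally show "\<bar>det B\<bar> ^ (CARD('p) choose k) \<le> \<dots>" .
  qed
qed

text \<open>Forster's position theorem up to \<open>\<epsilon>\<close>: a near-minimiser of the scale invariant potential
  \<open>(\<Prod>p. \<bar>B x\<^sub>p\<bar>)\<^sup>c / \<bar>det B\<bar>\<^sup>b\<close> cannot be improved by stretching along any \<open>v\<close>, so
  every direction carries nearly its fair share of the normalised vectors. Fixing the complement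
  of \<open>V\<close> makes the ambient determinant play the role of the determinant on \<open>V\<close>.\<close>

lemma forster_position_approx:
  fixes x :: "'p::finite \<Rightarrow> real^'m"
  assumes V: "subspace V" and xV: "\<And>p. x p \<in> V" and k: "k = dim V" "k \<ge> 1" "k \<le> CARD('p)"
    and gen: "\<And>S. card S \<le> k \<Longrightarrow> inj_on x S \<and> independent (x ` S)"
    and t: "0 < t" "t \<le> 1"
  obtains B :: "real^'m^'m" where "det B \<noteq> 0" "\<And>w. w \<in> V\<^sup>\<bottom> \<Longrightarrow> B *v w = w"
    "\<And>v. v \<in> V \<Longrightarrow> norm v = 1 \<Longrightarrow>
      real CARD('p) / real k * (1 - 3 * t) \<le> (\<Sum>p\<in>UNIV. (v \<bullet> (B *v x p) / norm (B *v x p))\<^sup>2)"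
proof -
  \<comment> \<open>\<open>b\<close> counts all \<open>k\<close>-subsets and \<open>c\<close> those
    through a given point; \<open>b / c = CARD('p) / k\<close> is the fair share in the
    conclusion.\<close>
  define b c where "b = CARD('p) choose k" and "c = (CARD('p) - 1) choose (k - 1)"
  have bc: "real b / real c = real CARD('p) / real k" and b: "b > 0" and c: "c > 0"
  proof -
    show "b > 0" "c > 0" using k by (auto simp: b_def c_def)
    have "k * b = CARD('p) * c"
      using times_binomial_minus1_eq[of k "CARD('p)"] k by (simp add: b_def c_def)
    then have "real k * real b = real CARD('p) * real c" by (metis of_nat_mult)
    then show "real b / real c = real CARD('p) / real k" using \<open>c > 0\<close> k(2) by (simp add: field_simps del: One_nat_def)
  qed
  define good :: "(real^'m^'m) set" where "good = {B. det B \<noteq> 0 \<and> (\<forall>w\<in>V\<^sup>\<bottom>. B *v w = w)}"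
  define F where "F B = (\<Prod>p\<in>UNIV. norm (B *v x p)) ^ c / \<bar>det B\<bar> ^ b" for B :: "real^'m^'m"
  obtain C where C: "C > 0" "\<And>B :: real^'m^'m. (\<forall>w\<in>V\<^sup>\<bottom>. B *v w = w) \<Longrightarrow>
      \<bar>det B\<bar> ^ b \<le> C * (\<Prod>p\<in>UNIV. norm (B *v x p)) ^ c"
    using potential_bounded_below[OF V xV k(1,2) gen] unfolding b_def c_def by metis
  have F_lower: "1 / C \<le> F B" if "B \<in> good" for B
    using C(2)[of B] that C(1) by (simp add: F_def good_def field_simps)
  define m where "m = Inf (F ` good)"
  have "mat 1 \<in> good" by (simp add: good_def)
  then have ne: "F ` good \<noteq> {}" by blast
  have "1 / C \<le> m" unfolding m_def using ne F_lower by (intro cInf_greatest) auto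
  then have m: "m > 0" using C(1) by (meson less_le_trans zero_less_divide_1_iff)
  have m_le: "m \<le> F B" if "B \<in> good" for B
    unfolding m_def using that F_lower by (intro cInf_lower bdd_belowI2[of _ "1 / C"]) auto
  \<comment> \<open>The slack is quadratic in \<open>t\<close>, like the error in
    \<open>ln (1 + t) \<ge> t - t^2\<close>; after division by \<open>t\<close> both cost only a
    relative error of order \<open>t\<close>.\<close>
  define \<eta> where "\<eta> = real b * t\<^sup>2"
  have "\<eta> > 0" using b t by (simp add: \<eta>_def)
  then have "m < m * exp \<eta>" using m by simp
  then obtain B where B: "B \<in> good" "F B < m * exp \<eta>"
    unfolding m_def using cInf_lessD[OF ne] by auto
  show ?thesis
  proof
    show "det B \<noteq> 0" "\<And>w. w \<in> V\<^sup>\<bottom> \<Longrightarrow> B *v w = w" using B by (auto simp: good_def)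
    fix v assume v: "v \<in> V" "norm v = 1"
    let ?a = "\<lambda>p. v \<bullet> (B *v x p) / norm (B *v x p)"
    define s where "s = (\<Sum>p\<in>UNIV. (?a p)\<^sup>2)"
    have Bx: "norm (B *v x p) > 0" for p
    proof -
      have "independent {x p}" using gen[of "{p}"] k by simp
      then have "x p \<noteq> 0" by (metis dependent_single)
      moreover have "inj ((*v) B)"
        using \<open>det B \<noteq> 0\<close> by (simp add: inj_matrix_vector_mult invertible_det_nz)
      ultimately show ?thesis by (metis injD matrix_vector_mult_0_right zero_less_norm_iff)
    qed
    \<comment> \<open>The competitor: stretching along \<open>v\<close> multiplies the determinant
      by \<open>1 + t\<close> and the norm of \<open>B *v x p\<close> by at most
      \<open>exp ((t + t^2 / 2) * (?a p)^2)\<close>.\<close>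
    let ?B = "rank_one_update t v ** B"
    have mul: "?B *v y = B *v y + (t * (v \<bullet> (B *v y))) *\<^sub>R v" for y
      by (simp add: rank_one_update_mult flip: matrix_vector_mul_assoc)
    have det: "det ?B = (1 + t) * det B"
      by (simp add: det_mul det_rank_one_update[OF v(2)])
    have "v \<bullet> w = 0" if "w \<in> V\<^sup>\<bottom>" for w
      using that v by (auto simp: orthogonal_comp_def orthogonal_def)
    then have good: "?B \<in> good"
      using B t by (auto simp: good_def mul det)
    have stretch: "norm (?B *v x p) \<le> norm (B *v x p) * exp ((t + t\<^sup>2 / 2) * (?a p)\<^sup>2)" for p
    proof (rule power2_le_imp_le)
      let ?z = "B *v x p"
      have "(norm (?B *v x p))\<^sup>2 = (norm ?z)\<^sup>2 + (2 * t + t\<^sup>2) * (v \<bullet> ?z)\<^sup>2"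
        using v(2) unfolding mul power2_norm_eq_inner
        by (simp add: inner_add_left inner_add_right inner_commute norm_eq_1 power2_eq_square algebra_simps)
      also have "\<dots> = (norm ?z)\<^sup>2 * (1 + (2 * t + t\<^sup>2) * (?a p)\<^sup>2)"
        using Bx[of p] by (simp add: field_simps power_divide)
      also have "\<dots> \<le> (norm ?z)\<^sup>2 * exp ((2 * t + t\<^sup>2) * (?a p)\<^sup>2)"
        by (intro mult_left_mono exp_ge_add_one_self) auto
      also have "\<dots> = (norm ?z * exp ((t + t\<^sup>2 / 2) * (?a p)\<^sup>2))\<^sup>2"
      proof -
        have "(2 * t + t\<^sup>2) * (?a p)\<^sup>2 = 2 * ((t + t\<^sup>2 / 2) * (?a p)\<^sup>2)" by (simp add: algebra_simps)
        then show ?thesis by (simp only: exp_double power_mult_distrib)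
      qed
      finally show "(norm (?B *v x p))\<^sup>2 \<le> \<dots>" .
    qed simp
    have "(\<Prod>p\<in>UNIV. norm (?B *v x p)) \<le> (\<Prod>p\<in>UNIV. norm (B *v x p) * exp ((t + t\<^sup>2 / 2) * (?a p)\<^sup>2))"
      using stretch by (intro prod_mono) auto
    also have "\<dots> = (\<Prod>p\<in>UNIV. norm (B *v x p)) * exp ((t + t\<^sup>2 / 2) * s)"
      by (simp add: prod.distrib s_def sum_distrib_left exp_sum)
    finally have "(\<Prod>p\<in>UNIV. norm (?B *v x p)) ^ c \<le>
        ((\<Prod>p\<in>UNIV. norm (B *v x p)) * exp ((t + t\<^sup>2 / 2) * s)) ^ c"
      by (intro power_mono prod_nonneg) auto
    then have "F ?B \<le> ((\<Prod>p\<in>UNIV. norm (B *v x p)) * exp ((t + t\<^sup>2 / 2) * s)) ^ c / \<bar>det ?B\<bar> ^ b"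
      unfolding F_def by (rule divide_right_mono) simp
    also have "\<dots> = F B * exp (c * ((t + t\<^sup>2 / 2) * s)) / (1 + t) ^ b"
      using t by (simp add: F_def det abs_mult power_mult_distrib exp_of_nat_mult)
    finally have "m \<le> F B * exp (c * ((t + t\<^sup>2 / 2) * s)) / (1 + t) ^ b"
      using m_le[OF good] by linarith
    then have "m * (1 + t) ^ b \<le> F B * exp (c * ((t + t\<^sup>2 / 2) * s))"
      using t by (simp add: pos_le_divide_eq)
    also have "\<dots> < m * exp \<eta> * exp (c * ((t + t\<^sup>2 / 2) * s))"
      using B by simp
    finally have "(1 + t) ^ b < exp (\<eta> + c * ((t + t\<^sup>2 / 2) * s))"
      using m by (simp add: exp_add mult.assoc)
    moreover have "exp (b * (t - t\<^sup>2)) \<le> (1 + t) ^ b"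
    proof -
      have "t - t\<^sup>2 \<le> ln (1 + t)" using t by (intro ln_one_plus_pos_lower_bound) auto
      then have "exp (t - t\<^sup>2) \<le> 1 + t" using t by (simp add: ln_ge_iff)
      then have "exp (t - t\<^sup>2) ^ b \<le> (1 + t) ^ b" by (intro power_mono) auto
      then show ?thesis by (simp add: exp_of_nat_mult)
    qed
    ultimately have "exp (b * (t - t\<^sup>2)) < exp (\<eta> + c * ((t + t\<^sup>2 / 2) * s))" by linarith
    then have "b * (t - t\<^sup>2) < \<eta> + c * ((t + t\<^sup>2 / 2) * s)" by simp
    then have "t * (b * (1 - 2 * t)) < t * (c * s * (1 + t / 2))"
      by (simp add: \<eta>_def power2_eq_square algebra_simps)
    then have *: "b * (1 - 2 * t) < c * s * (1 + t / 2)" using t by simp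
    have "(b * (1 - 3 * t)) * (1 + t / 2) \<le> b * (1 - 2 * t)"
    proof -
      have "(1 - 3 * t) * (1 + t / 2) \<le> 1 - 2 * t" using t by (simp add: algebra_simps)
      then show ?thesis using mult_left_mono[of _ _ "real b"] by (simp add: mult.assoc)
    qed
    also note *
    finally have "b * (1 - 3 * t) < c * s" using t by simp
    then have "b / c * (1 - 3 * t) \<le> s" using c by (simp add: field_simps)
    then show "real CARD('p) / real k * (1 - 3 * t) \<le> (\<Sum>p\<in>UNIV. (?a p)\<^sup>2)"
      by (simp add: bc s_def)
  qed
qed

section \<open>Perturbation to general position\<close>

text \<open>A finite union of subspaces is closed, so a point avoiding the earlier ones may be moved
  slightly; a short step along some \<open>z \<in> V - U\<close> leaves \<open>U\<close> as
  well.\<close>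

lemma avoid_subspaces:
  fixes V :: "'a::euclidean_space set"
  assumes "finite \<U>" "\<And>U. U \<in> \<U> \<Longrightarrow> subspace U \<and> \<not> V \<subseteq> U" "subspace V" "x \<in> V" "e > 0"
  shows "\<exists>y\<in>V. norm (y - x) < e \<and> (\<forall>U\<in>\<U>. y \<notin> U)"
  using assms
proof (induction \<U>)
  case empty
  then show ?case by (intro bexI[of _ x]) auto
next
  case (insert U \<U>)
  then obtain y where y: "y \<in> V" "norm (y - x) < e" "\<forall>U\<in>\<U>. y \<notin> U" by auto
  show ?case
  proof (cases "y \<in> U")
    case False
    then show ?thesis using y by auto
  next
    case True
    obtain z where z: "z \<in> V" "z \<notin> U" using insert.prems by auto
    have "closed (\<Union>\<U>)" using insert by (intro closed_Union) (auto intro: closed_subspace)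
    then have "open (ball x e - \<Union>\<U>)" by (intro open_Diff) auto
    moreover have "y \<in> ball x e - \<Union>\<U>" using y by (auto simp: dist_norm norm_minus_commute)
    ultimately obtain r where r: "r > 0" "ball y r \<subseteq> ball x e - \<Union>\<U>"
      using open_contains_ball by blast
    have z0: "z \<noteq> 0" using z insert.prems subspace_0 by auto
    define t where "t = r / (2 * norm z)"
    have t: "t > 0" using r z0 by (simp add: t_def)
    have "norm (t *\<^sub>R z) < r" using r z0 by (simp add: t_def)
    then have in_ball: "y + t *\<^sub>R z \<in> ball x e - \<Union>\<U>" using r by (auto simp: dist_norm subset_iff)
    have "y + t *\<^sub>R z \<notin> U"
    proof
      assume "y + t *\<^sub>R z \<in> U"
      then have "(y + t *\<^sub>R z) - y \<in> U" using True insert.prems by (intro subspace_diff) auto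
      then have "t *\<^sub>R z \<in> U" by simp
      moreover have "subspace U" using insert.prems by auto
      ultimately have "(1 / t) *\<^sub>R (t *\<^sub>R z) \<in> U" by (rule subspace_scale[rotated])
      then show False using z t by simp
    qed
    moreover have "y + t *\<^sub>R z \<in> V" using y z insert.prems by (intro subspace_add subspace_scale) auto
    ultimately show ?thesis
      using in_ball by (intro bexI[of _ "y + t *\<^sub>R z"]) (auto simp: dist_norm norm_minus_commute)
  qed
qed

text \<open>Points are replaced one at a time, each avoiding the spans of fewer than
  \<open>k\<close> earlier ones; these spans have dimension below \<open>k \<le> dim V\<close>, so
  none contains \<open>V\<close>.\<close>

lemma perturb_to_general_position:
  fixes V :: "'a::euclidean_space set" and x :: "'p::finite \<Rightarrow> 'a"
  assumes V: "subspace V" and x: "\<And>p. x p \<in> V" and e: "e > 0" and k: "k \<le> dim V"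
  obtains y where "\<And>p. y p \<in> V" "\<And>p. norm (y p - x p) < e"
    "\<And>S. card S \<le> k \<Longrightarrow> inj_on y S \<and> independent (y ` S)"
proof -
  have "\<exists>y. (\<forall>p. y p \<in> V \<and> norm (y p - x p) < e) \<and>
      (\<forall>S\<subseteq>P. card S \<le> k \<longrightarrow> inj_on y S \<and> independent (y ` S))" if "finite P" for P
    using that
  proof (induction P)
    case empty
    show ?case using x e by (intro exI[of _ x]) (auto simp: independent_empty)
  next
    case (insert p P)
    then obtain y where y: "\<And>p. y p \<in> V" "\<And>p. norm (y p - x p) < e"
      "\<And>S. S \<subseteq> P \<Longrightarrow> card S \<le> k \<Longrightarrow> inj_on y S \<and> independent (y ` S)" by blast
    let ?U = "(\<lambda>T. span (y ` T)) ` {T. T \<subseteq> P \<and> card T < k}"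
    have "\<exists>z\<in>V. norm (z - x p) < e \<and> (\<forall>U\<in>?U. z \<notin> U)"
    proof (rule avoid_subspaces)
      fix U assume "U \<in> ?U"
      then obtain T where T: "U = span (y ` T)" "card T < k" by auto
      have "dim U \<le> card T"
        unfolding T by (metis card_image_le dim_le_card dim_span finite finite_imageI order_trans span_superset dim_le_card')
      then have "dim U < dim V" using T k by simp
      then have "\<not> V \<subseteq> U" using dim_subset[of V U] by auto
      then show "subspace U \<and> \<not> V \<subseteq> U" using T by simp
    qed (use V x e in auto)
    then obtain z where z: "z \<in> V" "norm (z - x p) < e" "\<And>T. T \<subseteq> P \<Longrightarrow> card T < k \<Longrightarrow> z \<notin> span (y ` T)"
      by auto
    have "inj_on (y(p := z)) S \<and> independent (y(p := z) ` S)" if S: "S \<subseteq> insert p P" "card S \<le> k" for S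
    proof (cases "p \<in> S")
      case False
      then have SP: "S \<subseteq> P" using S by auto
      have "inj_on (y(p := z)) S = inj_on y S" using False by (intro inj_on_cong) auto
      moreover have "y(p := z) ` S = y ` S" using False by auto
      ultimately show ?thesis using y(3)[OF SP S(2)] by simp
    next
      case True
      define T where "T = S - {p}"
      have T: "S = insert p T" "p \<notin> T" "T \<subseteq> P" "card T < k"
        using True S card_Diff1_less[of S p] by (auto simp: T_def)
      have yT: "inj_on y T" "independent (y ` T)" using y(3)[of T] T by auto
      have zT: "z \<notin> span (y ` T)" using z T by auto
      have im: "y(p := z) ` T = y ` T" using T by auto
      have "inj_on (y(p := z)) T" using yT T by (auto simp: inj_on_def)
      moreover have "z \<notin> y ` T" using zT span_superset[of "y ` T"] by auto
      ultimately show ?thesis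
        using T zT yT im by (simp add: independent_insertI)
    qed
    moreover have "\<forall>q. (y(p := z)) q \<in> V \<and> norm ((y(p := z)) q - x q) < e" using y z by simp
    ultimately show ?case by blast
  qed
  from this[of UNIV] show ?thesis using that by auto
qed

section \<open>The rank bound for weighted sign patterns\<close>

text \<open>With \<open>G\<close> the cosines of the repositioned vectors, the sum of
  \<open>W p h * G p h\<close> is estimated twice: from below by
  \<open>\<bar>G p h\<bar> \<ge> (G p h)^2\<close> and near isotropy, from above by Cauchy-Schwarz
  and \<open>op\<close>.\<close>

lemma forster_bound:
  fixes M :: "real^'h^'p" and W :: "'p \<Rightarrow> 'h \<Rightarrow> real" and \<theta> K :: real
  assumes nz: "\<And>p h. M $ p $ h \<noteq> 0"
    and sgn: "\<And>p h. sgn (W p h) = sgn (M $ p $ h)"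
    and W: "\<And>p h. \<theta> \<le> \<bar>W p h\<bar>" and \<theta>: "\<theta> \<ge> 0"
    and op: "\<And>u :: 'p \<Rightarrow> real^'h. (\<And>p. norm (u p) = 1) \<Longrightarrow>
      (\<Sum>h\<in>UNIV. (norm (\<Sum>p\<in>UNIV. W p h *\<^sub>R u p))\<^sup>2) \<le> K"
  shows "\<theta> * CARD('p) * CARD('h) \<le> rank M * sqrt (CARD('h) * K)"
proof -
  define k where "k = rank M"
  define V where "V = span (rows M)"
  have V: "subspace V" by (simp add: V_def)
  have kV: "k = dim V" by (simp add: k_def V_def row_rank_def)
  have "M \<noteq> 0" using nz by (metis zero_index)
  then have k1: "k \<ge> 1" by (simp add: k_def Suc_le_eq rank_eq_0 flip: neq0_conv)
  have kp: "k \<le> CARD('p)" unfolding k_def using rank_bound[of M] by simp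
  have rowV: "row p M \<in> V" for p
    unfolding V_def by (rule span_base) (auto simp: rows_def)
  \<comment> \<open>The projection of \<open>axis h 1\<close> to \<open>V\<close> represents the
    \<open>h\<close>-th coordinate there, so entries of \<open>M\<close> become inner products
    inside \<open>V\<close>.\<close>
  have "\<exists>y\<in>V. \<forall>x\<in>V. x \<bullet> y = x $ h" for h
  proof -
    obtain y z where yz: "y \<in> V" "\<And>w. w \<in> V \<Longrightarrow> orthogonal z w" "axis h 1 = y + z"
      using orthogonal_subspace_decomp_exists[of "rows M" "axis h (1 :: real)"]
      unfolding V_def by metis
    have "x \<bullet> y = x $ h" if "x \<in> V" for x
    proof -
      have "x $ h = x \<bullet> (y + z)" using yz(3) by (metis cart_eq_inner_axis)
      then show ?thesis using yz(2)[OF that] by (simp add: inner_add_right orthogonal_def inner_commute)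
    qed
    then show ?thesis using yz(1) by blast
  qed
  then obtain y where y: "\<And>h. y h \<in> V" "\<And>h x. x \<in> V \<Longrightarrow> x \<bullet> y h = x $ h" by metis
  \<comment> \<open>Row perturbations shorter than the smallest modulus of an entry change no
    sign.\<close>
  define e where "e = Min (range (\<lambda>(p, h). \<bar>M $ p $ h\<bar>))"
  have e: "e > 0" "\<And>p h. e \<le> \<bar>M $ p $ h\<bar>"
  proof -
    show "e > 0" unfolding e_def using nz by (subst Min_gr_iff) auto
    show "e \<le> \<bar>M $ p $ h\<bar>" for p h
      unfolding e_def by (rule Min_le) (auto intro: range_eqI[of _ _ "(p, h)"])
  qed
  obtain x where x: "\<And>p. x p \<in> V" "\<And>p. norm (x p - row p M) < e"
    and gen: "\<And>S. card S \<le> k \<Longrightarrow> inj_on x S \<and> independent (x ` S)"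
    using perturb_to_general_position[of V "\<lambda>p. row p M", OF V rowV e(1) eq_refl[OF kV]] by blast
  have sgnx: "sgn (x p \<bullet> y h) = sgn (W p h)" for p h
  proof -
    have "\<bar>(x p - row p M) $ h\<bar> < \<bar>M $ p $ h\<bar>"
      using component_le_norm_cart[of "x p - row p M" h] x(2)[of p] e(2)[of p h] by linarith
    then have "sgn (x p $ h) = sgn (M $ p $ h)"
      by (auto simp: row_def sgn_real_def)
    then show ?thesis using y(2)[OF x(1)] sgn by simp
  qed
  have approx: "\<theta> * CARD('h) * (CARD('p) / k * (1 - 3 * t)) \<le> sqrt (CARD('h) * K)"
    if t: "0 < t" "t \<le> 1" for t
  proof -
    obtain B where B: "det B \<noteq> 0" "\<And>w. w \<in> V\<^sup>\<bottom> \<Longrightarrow> B *v w = w"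
      "\<And>v. v \<in> V \<Longrightarrow> norm v = 1 \<Longrightarrow>
      real CARD('p) / real k * (1 - 3 * t) \<le> (\<Sum>p\<in>UNIV. (v \<bullet> (B *v x p) / norm (B *v x p))\<^sup>2)"
      by (rule forster_position_approx[of V x, OF V x(1) kV k1 kp gen t]) blast+
    have "invertible (transpose B)" using B(1) by (simp add: invertible_det_nz)
    then obtain B' where B': "transpose B ** B' = mat 1" by (auto simp: invertible_def)
    \<comment> \<open>\<open>B'\<close> inverts the transpose of \<open>B\<close>, so inner products
      with \<open>B *v x p\<close> agree with the old ones and the signs survive.\<close>
    define z where "z h = B' *v y h" for h
    have z: "transpose B *v z h = y h" for h
      by (simp add: z_def matrix_vector_mul_assoc B' del: transpose_matrix_vector)
    have zx: "z h \<bullet> (B *v w) = y h \<bullet> w" for h w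
      using z[of h] by (metis dot_lmul_matrix transpose_matrix_vector)
    \<comment> \<open>Near isotropy is available only for directions in \<open>V\<close>;
      \<open>z h\<close> stays there because \<open>B\<close> fixes the complement
      pointwise.\<close>
    have zV: "z h \<in> V" for h
    proof -
      have "z h \<in> V\<^sup>\<bottom>\<^sup>\<bottom>"
        unfolding orthogonal_comp_def[of "V\<^sup>\<bottom>"] orthogonal_def
      proof safe
        fix w assume w: "w \<in> V\<^sup>\<bottom>"
        then have "z h \<bullet> w = y h \<bullet> w" using zx[of h w] B(2) by simp
        also have "\<dots> = 0" using w y(1) by (auto simp: orthogonal_comp_def orthogonal_def)
        finally show "w \<bullet> z h = 0" by (simp add: inner_commute)
      qed
      then show ?thesis by (simp add: orthogonal_comp_self[OF V])
    qed
    define G where "G p h = (z h \<bullet> (B *v x p)) / (norm (z h) * norm (B *v x p))" for p h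
    have pos: "norm (z h) > 0" "norm (B *v x p) > 0" for p h
    proof -
      have "z h \<bullet> (B *v x p) \<noteq> 0"
        using sgnx[of p h] sgn[of p h] nz[of p h] zx[of h "x p"]
        by (auto simp: inner_commute sgn_zero_iff)
      then show "norm (z h) > 0" "norm (B *v x p) > 0" by auto
    qed
    define u where "u p = B *v x p /\<^sub>R norm (B *v x p)" for p
    define v where "v h = z h /\<^sub>R norm (z h)" for h
    have u: "norm (u p) = 1" for p using pos(2)[of p] by (simp add: u_def)
    have v: "norm (v h) = 1" "v h \<in> V" for h
      using pos(1)[of h] zV V by (auto simp: v_def subspace_scale)
    have uv: "v h \<bullet> u p = G p h" for p h
      by (simp add: u_def v_def G_def divide_inverse mult_ac)
    have sgnG: "sgn (W p h) = sgn (G p h)" for p h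
      unfolding G_def using pos(1)[of h] pos(2)[of p] zx[of h "x p"] sgnx[of p h]
      by (simp add: sgn_divide sgn_mult inner_commute)
    have WG: "W p h * G p h = \<bar>W p h\<bar> * \<bar>G p h\<bar>" for p h
      using sgnG[of p h] by (simp add: sgn_if abs_if split: if_splits)
    have G1: "\<bar>G p h\<bar> \<le> 1" for p h
      using Cauchy_Schwarz_ineq2[of "v h" "u p"] by (simp add: uv u v)
    have lower: "\<theta> * (CARD('p) / k * (1 - 3 * t)) \<le> (\<Sum>p\<in>UNIV. W p h * G p h)" for h
    proof -
      have "CARD('p) / k * (1 - 3 * t) \<le> (\<Sum>p\<in>UNIV. (G p h)\<^sup>2)"
        using B(3)[OF v(2)[of h] v(1)[of h]] by (simp add: v_def G_def divide_inverse mult_ac)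
      from mult_left_mono[OF this \<theta>]
      have "\<theta> * (CARD('p) / k * (1 - 3 * t)) \<le> (\<Sum>p\<in>UNIV. \<theta> * (G p h)\<^sup>2)"
        by (simp only: sum_distrib_left)
      also have "\<dots> \<le> (\<Sum>p\<in>UNIV. W p h * G p h)"
      proof (rule sum_mono)
        fix p
        have "(G p h)\<^sup>2 \<le> \<bar>G p h\<bar>"
          using G1[of p h] mult_left_mono[of "\<bar>G p h\<bar>" 1 "\<bar>G p h\<bar>"] by (simp add: power2_eq_square)
        then show "\<theta> * (G p h)\<^sup>2 \<le> W p h * G p h"
          unfolding WG using W \<theta> by (intro mult_mono) auto
      qed
      finally show ?thesis .
    qed
    have "\<theta> * CARD('h) * (CARD('p) / k * (1 - 3 * t)) = (\<Sum>h\<in>(UNIV :: 'h set). \<theta> * (CARD('p) / k * (1 - 3 * t)))"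
      by simp
    also have "\<dots> \<le> (\<Sum>h\<in>UNIV. \<Sum>p\<in>UNIV. W p h * G p h)"
      by (rule sum_mono) (rule lower)
    also have "\<dots> = (\<Sum>h\<in>UNIV. v h \<bullet> (\<Sum>p\<in>UNIV. W p h *\<^sub>R u p))"
      by (simp add: inner_sum_right uv)
    also have "\<dots> \<le> (\<Sum>h\<in>UNIV. norm (\<Sum>p\<in>UNIV. W p h *\<^sub>R u p))"
    proof (rule sum_mono)
      fix h
      show "v h \<bullet> (\<Sum>p\<in>UNIV. W p h *\<^sub>R u p) \<le> norm (\<Sum>p\<in>UNIV. W p h *\<^sub>R u p)"
        using norm_cauchy_schwarz[of "v h" "\<Sum>p\<in>UNIV. W p h *\<^sub>R u p"] v(1)[of h] by simp
    qed
    also have "\<dots> \<le> sqrt (CARD('h) * K)"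
    proof (rule real_le_rsqrt)
      have "(\<Sum>h\<in>UNIV. norm (\<Sum>p\<in>UNIV. W p h *\<^sub>R u p))\<^sup>2
        \<le> (\<Sum>h\<in>UNIV. (norm (\<Sum>p\<in>UNIV. W p h *\<^sub>R u p))\<^sup>2) * CARD('h)"
        by (rule sum_squared_le_sum_of_squares)
      also have "\<dots> \<le> K * CARD('h)" using op[OF u] by (intro mult_right_mono) auto
      finally show "(\<Sum>h\<in>UNIV. norm (\<Sum>p\<in>UNIV. W p h *\<^sub>R u p))\<^sup>2 \<le> CARD('h) * K"
        by (simp add: mult.commute)
    qed
    finally show ?thesis .
  qed
  have "\<theta> * CARD('h) * (CARD('p) / k) \<le> sqrt (CARD('h) * K)"
  proof (rule field_le_mult_one_interval)
    \<comment> \<open>Taking \<open>t = (1 - s) / 3\<close> turns \<open>1 - 3 * t\<close> into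
      \<open>s\<close>, which may be arbitrarily close to \<open>1\<close>.\<close>
    fix s :: real assume "0 < s" "s < 1"
    then have "\<theta> * CARD('h) * (CARD('p) / k * (1 - 3 * ((1 - s) / 3))) \<le> sqrt (CARD('h) * K)"
      by (intro approx) auto
    moreover have "1 - 3 * ((1 - s) / 3) = s" by (simp add: field_simps)
    ultimately show "s * (\<theta> * CARD('h) * (CARD('p) / k)) \<le> sqrt (CARD('h) * K)"
      by (simp only: mult_ac)
  qed
  then show ?thesis using k1 by (simp add: k_def field_simps)
qed

section \<open>The incidence matrix\<close>

context finite_projective_space
begin

lemma theta_Suc_dim: "theta d = 1 + n * theta (d - 1)" "theta d = theta (d - 1) + n ^ (d - 1)"
  using theta_Suc[of "d - 1"] theta_Suc'[of "d - 1"] dim_pos by auto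

text \<open>With \<open>N = theta (d + 1)\<close> points, block size \<open>k = theta d\<close> and
  pair count \<open>\<lambda> = theta (d - 1)\<close>, this is the design identity
  \<open>k^2 = \<lambda> * N + (k - \<lambda>)\<close>.\<close>

lemma theta_square: "theta d * theta d = theta (d - 1) * theta (d + 1) + n ^ (d - 1)"
proof -
  have "theta d * theta d + theta (d - 1) = theta d * (1 + n * theta (d - 1)) + theta (d - 1)"
    using theta_Suc_dim(1) by simp
  also have "\<dots> = theta (d - 1) * theta (d + 1) + theta d"
    by (simp add: theta_Suc algebra_simps)
  finally show ?thesis using theta_Suc_dim(2) by simp
qed

lemma of_nat_theta: "real (theta r) * (real n - 1) = real n ^ r - 1"
  by (induction r) (auto simp: theta_Suc' algebra_simps)

lemma sum_signs_point:
  assumes "bij_betw hyp (UNIV :: 'h::finite set) (hyperplanes lines d)"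
  shows "(\<Sum>h\<in>UNIV. if p \<in> hyp h then 1 else 0 :: real) = theta d"
    and "p \<noteq> q \<Longrightarrow> (\<Sum>h\<in>UNIV. if p \<in> hyp h \<and> q \<in> hyp h then 1 else 0 :: real) = theta (d - 1)"
proof -
  have *: "(\<Sum>h\<in>UNIV. if P (hyp h) then 1 else 0 :: real) = card {H \<in> hyperplanes lines d. P H}" for P
    using sum.reindex_bij_betw[OF assms, of "\<lambda>H. if P H then 1 else 0 :: real"]
    by (simp add: sum.If_cases Int_def)
  show "(\<Sum>h\<in>UNIV. if p \<in> hyp h then 1 else 0 :: real) = theta d"
    using *[of "\<lambda>H. p \<in> H"] card_hyperplanes_point by simp
  show "p \<noteq> q \<Longrightarrow> (\<Sum>h\<in>UNIV. if p \<in> hyp h \<and> q \<in> hyp h then 1 else 0 :: real) = theta (d - 1)"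
    using *[of "\<lambda>H. p \<in> H \<and> q \<in> H"] card_hyperplanes_two_points by simp
qed

lemma card_columns:
  assumes "bij_betw hyp (UNIV :: 'h::finite set) (hyperplanes lines d)"
  shows "CARD('h) = theta (d + 1)"
  using bij_betw_same_card[OF assms] card_hyperplanes by simp

text \<open>Any two points lie on equally many common hyperplanes, so the Gram matrix of the rows is
  a multiple of the identity plus a constant matrix.\<close>

lemma shifted_incidence_gram:
  fixes \<theta> :: real
  assumes hyp: "bij_betw hyp (UNIV :: 'h::finite set) (hyperplanes lines d)"
  defines "W \<equiv> \<lambda>p h. (if p \<in> hyp h then 1 else 0) - \<theta>"
  shows "(\<Sum>h\<in>UNIV. W p h * W q h) =
    (if p = q then real n ^ (d - 1) else 0) + (theta (d - 1) - 2 * \<theta> * theta d + \<theta>\<^sup>2 * theta (d + 1))"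
proof -
  have "(\<Sum>h\<in>UNIV. W p h * W q h) = (\<Sum>h\<in>UNIV. (if p \<in> hyp h \<and> q \<in> hyp h then 1 else 0)
      - \<theta> * (if p \<in> hyp h then 1 else 0) - \<theta> * (if q \<in> hyp h then 1 else 0) + \<theta>\<^sup>2)"
    by (intro sum.cong) (auto simp: W_def power2_eq_square algebra_simps)
  also have "\<dots> = (\<Sum>h\<in>UNIV. if p \<in> hyp h \<and> q \<in> hyp h then 1 else 0)
      - 2 * \<theta> * theta d + \<theta>\<^sup>2 * theta (d + 1)"
    by (simp only: sum.distrib sum_subtractf sum_signs_point[OF hyp] card_columns[OF hyp]
        sum_constant flip: sum_distrib_left) simp
  also have "(\<Sum>h\<in>UNIV. if p \<in> hyp h \<and> q \<in> hyp h then 1 else 0 :: real) =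
      (if p = q then real n ^ (d - 1) else 0) + theta (d - 1)"
    using sum_signs_point[OF hyp, of p] sum_signs_point(2)[OF hyp, of p q] theta_Suc_dim(2) by auto
  finally show ?thesis by simp
qed

text \<open>The identity part of the Gram matrix gives the bound. The constant part contributes a
  nonpositive multiple of the squared norm of the sum of all \<open>u p\<close> and is
  discarded.\<close>

lemma shifted_incidence_operator_bound:
  fixes u :: "'a \<Rightarrow> 'v::real_inner" and \<theta> :: real
  assumes hyp: "bij_betw hyp (UNIV :: 'h::finite set) (hyperplanes lines d)"
    and u: "\<And>p. norm (u p) = 1"
    and \<theta>: "theta (d - 1) - 2 * \<theta> * theta d + \<theta>\<^sup>2 * theta (d + 1) \<le> 0"
  shows "(\<Sum>h\<in>UNIV. (norm (\<Sum>p\<in>UNIV. ((if p \<in> hyp h then 1 else 0) - \<theta>) *\<^sub>R u p))\<^sup>2)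
    \<le> real n ^ (d - 1) * theta (d + 1)"
proof -
  define W where "W p h = (if p \<in> hyp h then 1 else 0) - \<theta>" for p h
  define c where "c = theta (d - 1) - 2 * \<theta> * theta d + \<theta>\<^sup>2 * theta (d + 1)"
  have "(\<Sum>h\<in>UNIV. (norm (\<Sum>p\<in>UNIV. W p h *\<^sub>R u p))\<^sup>2)
      = (\<Sum>h\<in>UNIV. \<Sum>p\<in>UNIV. \<Sum>q\<in>UNIV. W p h * W q h * (u p \<bullet> u q))"
    by (simp add: power2_norm_eq_inner inner_sum_left inner_sum_right sum_distrib_left mult_ac inner_commute)
  also have "\<dots> = (\<Sum>p\<in>UNIV. \<Sum>h\<in>UNIV. \<Sum>q\<in>UNIV. W p h * W q h * (u p \<bullet> u q))"
    by (rule sum.swap)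
  also have "\<dots> = (\<Sum>p\<in>UNIV. \<Sum>q\<in>UNIV. \<Sum>h\<in>UNIV. W p h * W q h * (u p \<bullet> u q))"
    by (intro sum.cong refl sum.swap)
  also have "\<dots> = (\<Sum>p\<in>UNIV. \<Sum>q\<in>UNIV. ((if p = q then real n ^ (d - 1) else 0) + c) * (u p \<bullet> u q))"
    unfolding W_def c_def
    by (simp only: shifted_incidence_gram[OF hyp] flip: sum_distrib_right)
  also have "\<dots> = (\<Sum>p\<in>UNIV. real n ^ (d - 1) * (u p \<bullet> u p)) + c * (\<Sum>p\<in>UNIV. \<Sum>q\<in>UNIV. u p \<bullet> u q)"
    by (simp add: distrib_right sum.distrib sum_distrib_left if_distrib[where f = "\<lambda>x. x * _"] cong: if_cong)
  also have "(\<Sum>p\<in>UNIV. \<Sum>q\<in>UNIV. u p \<bullet> u q) = (norm (\<Sum>p\<in>UNIV. u p))\<^sup>2"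
    by (simp add: power2_norm_eq_inner inner_sum_left inner_sum_right inner_commute)
  also have "(\<Sum>p\<in>UNIV. real n ^ (d - 1) * (u p \<bullet> u p)) = real n ^ (d - 1) * theta (d + 1)"
    using u card_points by (simp add: norm_eq_1)
  also have "real n ^ (d - 1) * theta (d + 1) + c * (norm (\<Sum>p\<in>UNIV. u p))\<^sup>2 \<le> real n ^ (d - 1) * theta (d + 1)"
    using \<theta> by (simp add: c_def mult_nonpos_nonneg)
  finally show ?thesis by (simp add: W_def)
qed

lemma sign_rank_signed_incidence:
  assumes hyp: "bij_betw hyp (UNIV :: 'h::finite set) (hyperplanes lines d)" and n: "n \<ge> 3"
  shows "real (theta d) + 1 \<le> real (sign_rank (signed_incidence hyp)) * sqrt (real n ^ (d - 1))"
proof -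
  let ?A = "signed_incidence hyp"
  let ?N = "theta (d + 1)"
  \<comment> \<open>The incidence matrix realises its own signs, so the \<open>LEAST\<close> in
    \<open>sign_rank\<close> is attained by some \<open>M\<close>.\<close>
  have "\<exists>k. \<exists>M :: real^'h^'a. (\<forall>i j. M $ i $ j \<noteq> 0) \<and> (\<forall>i j. sgn (M $ i $ j) = ?A $ i $ j) \<and> rank M = k"
    by (intro exI[of _ "rank ?A"] exI[of _ ?A]) (simp add: signed_incidence_def)
  from LeastI_ex[OF this] obtain M :: "real^'h^'a" where M: "\<And>i j. M $ i $ j \<noteq> 0"
      "\<And>i j. sgn (M $ i $ j) = ?A $ i $ j" "rank M = sign_rank ?A"
    unfolding sign_rank_def by blast
  define \<theta> where "\<theta> = (real (theta d) + 1) / ?N"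
  have N: "real ?N > 0" using theta_less_iff[of 0 "d + 1"] by simp
  have d1: "theta d \<ge> 1" using theta_Suc_dim(1) by simp
  have \<theta>0: "\<theta> > 0" using N by (simp add: \<theta>_def)
  \<comment> \<open>This is where \<open>n \<ge> 3\<close> enters:
    \<open>\<theta> \<le> 1 / 2\<close> makes both values \<open>1 - \<theta>\<close> and
    \<open>- \<theta>\<close> at least \<open>\<theta>\<close> in modulus.\<close>
  have "2 * (theta d + 1) \<le> 1 + 3 * theta d" using d1 by simp
  also have "\<dots> \<le> ?N" using n by (simp add: theta_Suc)
  finally have \<theta>1: "\<theta> \<le> 1 / 2" using N by (simp add: \<theta>_def field_simps del: of_nat_sum)
  \<comment> \<open>\<open>?N\<close> times the coefficient is
    \<open>(?N * \<theta> - theta d)^2 - n ^ (d - 1)\<close>; the square is \<open>1\<close>, so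
    \<open>n ^ (d - 1) \<ge> 1\<close> suffices.\<close>
  have "theta (d - 1) * ?N + 1 \<le> theta d * theta d"
    using theta_square n by simp
  then have "real (theta (d - 1)) * ?N + 1 \<le> real (theta d) * theta d"
    by (metis of_nat_1 of_nat_add of_nat_le_iff of_nat_mult)
  then have "(real (theta (d - 1)) * ?N + 1 - real (theta d) * theta d) / ?N \<le> 0"
    using N by (simp add: divide_nonpos_pos)
  also have "(real (theta (d - 1)) * ?N + 1 - real (theta d) * theta d) / ?N
      = theta (d - 1) - 2 * \<theta> * theta d + \<theta>\<^sup>2 * ?N"
    using N by (simp add: \<theta>_def field_simps power2_eq_square)
  finally have coef: "theta (d - 1) - 2 * \<theta> * theta d + \<theta>\<^sup>2 * ?N \<le> 0" .
  have "\<theta> * CARD('a) * CARD('h) \<le> rank M * sqrt (CARD('h) * (real n ^ (d - 1) * ?N))"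
  proof (rule forster_bound[where W = "\<lambda>p h. (if p \<in> hyp h then 1 else 0) - \<theta>"])
    show "sgn ((if p \<in> hyp h then 1 else 0) - \<theta>) = sgn (M $ p $ h)" for p h
      using \<theta>0 \<theta>1 by (simp add: M(2) signed_incidence_def)
    show "\<theta> \<le> \<bar>(if p \<in> hyp h then 1 else 0) - \<theta>\<bar>" for p h
      using \<theta>0 \<theta>1 by auto
  qed (use M(1) \<theta>0 shifted_incidence_operator_bound[OF hyp _ coef] in auto)
  also have "sqrt (CARD('h) * (real n ^ (d - 1) * ?N)) = sqrt (real n ^ (d - 1)) * ?N"
    using card_columns[OF hyp] by (simp add: real_sqrt_mult)
  finally have "(\<theta> * ?N) * ?N \<le> (sign_rank ?A * sqrt (real n ^ (d - 1))) * ?N"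
    using card_points card_columns[OF hyp] M(3) by (simp add: mult_ac)
  then have "\<theta> * ?N \<le> sign_rank ?A * sqrt (real n ^ (d - 1))" using N by simp
  then show ?thesis using N by (simp add: \<theta>_def)
qed

section \<open>Comparison with the power of \<open>N\<close>, and assembly\<close>

text \<open>The second inequality of the theorem, raised to the power \<open>2 * d\<close> and
  cleared of denominators. It follows from \<open>theta (d + 1) \<le> (n + 1) * theta d\<close> and
  from keeping only the two top terms \<open>n ^ (d - 2) * (n + 1)\<close> of
  \<open>theta d\<close>.\<close>

lemma theta_power_bound:
  assumes "d \<ge> 2"
  shows "theta (d + 1) ^ (d - 1) * n ^ (d * (d - 1)) \<le> theta d ^ (2 * d)"
proof -
  obtain e where e: "d = e + 2" using assms by (metis add.commute le_Suc_ex)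
  let ?D = "theta d"
  have D: "n ^ e * (n + 1) \<le> ?D" by (simp add: e theta_Suc' numeral_2_eq_2)
  have "theta (d + 1) \<le> (n + 1) * ?D" using theta_Suc_dim(1) by (simp add: theta_Suc)
  then have "theta (d + 1) ^ (e + 1) * n ^ (d * (d - 1)) \<le> ((n + 1) * ?D) ^ (e + 1) * n ^ (d * (d - 1))"
    by (intro mult_right_mono power_mono) auto
  also have dd: "d * (d - 1) = e * (e + 3) + 2" by (simp add: e algebra_simps)
  also have "((n + 1) * ?D) ^ (e + 1) * n ^ (e * (e + 3) + 2)
      = ?D ^ (e + 1) * (n ^ (e * (e + 3)) * (n + 1) ^ (e + 1) * n ^ 2)"
    by (simp only: power_mult_distrib power_add mult_ac)
  \<comment> \<open>Two spare factors \<open>n\<close> are enlarged to \<open>n + 1\<close> to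
    complete \<open>(n + 1) ^ (e + 3)\<close>.\<close>
  also have "\<dots> \<le> ?D ^ (e + 1) * (n ^ (e * (e + 3)) * (n + 1) ^ (e + 1) * (n + 1) ^ 2)"
    by (intro mult_left_mono power_mono) auto
  also have "\<dots> = ?D ^ (e + 1) * (n ^ e * (n + 1)) ^ (e + 3)"
  proof -
    have "e + 3 = (e + 1) + 2" by simp
    then have "(n + 1) ^ (e + 3) = (n + 1) ^ (e + 1) * (n + 1) ^ 2" by (simp only: power_add)
    then show ?thesis by (simp only: power_mult_distrib power_mult mult.assoc)
  qed
  also have "\<dots> \<le> ?D ^ (e + 1) * ?D ^ (e + 3)"
    using D by (intro mult_left_mono power_mono) auto
  also have "\<dots> = ?D ^ (2 * d)"
  proof -
    have "2 * d = (e + 1) + (e + 3)" by (simp add: e)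
    then show ?thesis by (simp only: power_add)
  qed
  finally have *: "theta (d + 1) ^ (e + 1) * n ^ (e * (e + 3) + 2) \<le> ?D ^ (2 * d)" .
  have e1: "d - 1 = e + 1" by (simp add: e)
  show ?thesis unfolding dd unfolding e1 by (rule *)
qed

end

theorem theorem9:
  fixes lines :: "'p::finite set set"
    and hyp :: "'h::finite \<Rightarrow> 'p set"
    and d n N :: nat
    and A :: "real^'h^'p"
  assumes "d \<ge> 2" and "n \<ge> 3"
    and "projective_space lines"
    and "has_proj_dim lines UNIV d"
    and "has_order lines n"
    and "bij_betw hyp UNIV (hyperplanes lines d)"
    and "A = signed_incidence hyp"
    and "N = (\<Sum>i\<le>d. n ^ i)"
  shows "CARD('p) = N \<and> CARD('h) = N
    \<and> real N = (real n ^ (d + 1) - 1) / (real n - 1)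
    \<and> vc_dim A = d
    \<and> real (sign_rank A) > (real n ^ d - 1) / (real n powr ((real d - 1) / 2) * (real n - 1))
    \<and> (real n ^ d - 1) / (real n powr ((real d - 1) / 2) * (real n - 1))
        \<ge> real N powr (1 / 2 - 1 / (2 * real d))"
proof -
  interpret finite_projective_space lines n d
    using assms by unfold_locales (auto simp: projective_space_def)
  have N: "N = theta (d + 1)"
    using assms(8) by (simp add: theta_def lessThan_Suc_atMost)
  have Npos: "real N > 0" using theta_less_iff[of 0 "d + 1"] by (simp add: N)
  have n1: "real n - 1 > 0" "real n > 0" using assms(2) by auto
  define \<sigma> where "\<sigma> = real n powr ((real d - 1) / 2)"
  have \<sigma>: "\<sigma> > 0" using n1 by (simp add: \<sigma>_def)
  have "\<sigma>\<^sup>2 = real n powr ((real d - 1) / 2 * 2)"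
    using n1 by (simp add: \<sigma>_def powr_power mult.commute)
  also have "(real d - 1) / 2 * 2 = real (d - 1)"
    using assms(1) by (simp add: of_nat_diff)
  also have "real n powr real (d - 1) = real n ^ (d - 1)"
    using n1(2) by (rule powr_realpow)
  finally have "\<sigma>\<^sup>2 = real n ^ (d - 1)" .
  then have sqrt: "sqrt (real n ^ (d - 1)) = \<sigma>" using \<sigma> by (metis less_imp_le real_sqrt_unique)
  have ratio: "(real n ^ d - 1) / (\<sigma> * (real n - 1)) = theta d / \<sigma>"
    using n1 by (simp flip: of_nat_theta)
  \<comment> \<open>The summand \<open>1\<close> gained from the unbalanced shift makes the
    inequality strict.\<close>
  have "theta d / \<sigma> < sign_rank A"
    using sign_rank_signed_incidence[OF assms(6,2)] \<sigma> unfolding assms(7) sqrt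
    by (simp add: pos_divide_less_eq)
  moreover have "real N powr (1 / 2 - 1 / (2 * real d)) \<le> theta d / \<sigma>"
  proof -
    have "(real N powr (1 / 2 - 1 / (2 * real d)) * \<sigma>) ^ (2 * d)
        = real N powr ((1 / 2 - 1 / (2 * real d)) * (2 * d)) * real n powr ((real d - 1) / 2 * (2 * d))"
      unfolding \<sigma>_def power_mult_distrib using Npos n1(2)
      by (subst (1 2) powr_power) (simp_all add: mult.commute)
    also have "(1 / 2 - 1 / (2 * real d)) * (2 * d) = real (d - 1)"
      using assms(1) by (simp add: field_simps of_nat_diff)
    also have "(real d - 1) / 2 * (2 * d) = real (d * (d - 1))"
      using assms(1) by (simp add: of_nat_diff)
    also have "real N powr real (d - 1) * real n powr real (d * (d - 1)) = real (N ^ (d - 1) * n ^ (d * (d - 1)))"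
      using powr_realpow[OF Npos, of "d - 1"] powr_realpow[OF n1(2), of "d * (d - 1)"]
      by (simp only: of_nat_mult[of "N ^ (d - 1)"] of_nat_power)
    also have "\<dots> \<le> real (theta d ^ (2 * d))"
      using theta_power_bound[OF assms(1)] unfolding N by (intro of_nat_mono)
    finally have "(real N powr (1 / 2 - 1 / (2 * real d)) * \<sigma>) ^ (2 * d) \<le> real (theta d) ^ (2 * d)"
      by simp
    then have "real N powr (1 / 2 - 1 / (2 * real d)) * \<sigma> \<le> theta d"
      using assms(1) \<sigma> power_mono_iff[of "real N powr (1 / 2 - 1 / (2 * real d)) * \<sigma>" "theta d" "2 * d"]
      by simp
    then show ?thesis using \<sigma> by (simp add: pos_le_divide_eq)
  qed
  moreover have "real N = (real n ^ (d + 1) - 1) / (real n - 1)"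
    using n1 of_nat_theta[of "d + 1"] by (simp add: N eq_divide_eq)
  ultimately show ?thesis
    using card_points card_columns[OF assms(6)] vc_dim_signed_incidence[OF assms(6)] ratio N
    by (simp add: assms(7) \<sigma>_def)
qed

end
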